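(* Consider the stochastic differential delay equation $$dx(t)=f(x(t),x(t-\delta(t)),t)\,dt+g(x(t),x(t-\delta(t)),t)\,dB(t),\quad t\ge 0,\qquad x_0=\xi,$$ and its modified truncated Euler–Maruyama (MTEM) approximation $X_k^\Delta$, with the setting and notation of the context. Suppose $\tau>0$ and $\delta(t)\le\tau$ for all $t\ge0$. Assume: (i) there is a constant $\eta<1$ with $\delta'(t)\le\eta$ for all $t\ge0$; (ii) (local Lipschitz) for each $t\ge0$ and each $R$ there is $L_{R,t}>0$ (increasing in $R$) such that $$|f(x,y,t)-f(x',y',t)|\vee|g(x,y,t)-g(x',y',t)|\le L_{R,t}(|x-x'|+|y-y'|)$$ for all $|x|\vee|x'|\vee|y|\vee|y'|\le R$; (iii) there are positive constants $K,\lambda_0,\lambda_1,\lambda_2$ such that for all $t\ge0$ and $x,y\in\mathbb{R}^n$ $$2\langle x,f(x,y,t)\rangle+|g(x,y,t)|^2\le\frac{K(1+t)^{-\lambda_0}-\lambda_1|x|^2+\lambda_2|y|^2}{1+t};$$ (iv) $\lambda_1-\lambda_2([(1-\eta)^{-1}]+1)>0$; (v) $\displaystyle\lim_{R\to\infty}\sup_{t\ge0}(1+t)L_{R,t}^2\,h^{-1}(R)=0$, where $h^{-1}$ is the inverse function of $h$. Then the MTEM approximation $X_k^\Delta$ is both almost surely and mean square polynomially stable. Precisely, for any $$0<\varepsilon<\frac{\lambda_1-\lambda_2([(1-\eta)^{-1}]+1)}{[(1-\eta)^{-1}]+2}$$ there exist $\Delta^*>0$ and $\tilde C>0$ such that for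 any $\Delta\in(0,\Delta^*]$ and $C\in(0,\tilde C)$, $$\limsup_{k\to\infty}\frac{\log|X_k^\Delta|}{\log(1+k\Delta)}\le-\frac{C}{2}\ \text{ a.s.},\qquad\text{and}\qquad \limsup_{k\to\infty}\frac{\log\mathbb{E}(|X_k^\Delta|^2)}{\log(1+k\Delta)}\le-C,$$ where $\tilde C=\tilde C_0\wedge\lambda_0$ and $\tilde C_0$ is the unique positive solution of $$\tilde C_0-(\lambda_1-\varepsilon)+(\lambda_2+\varepsilon)([(1-\eta)^{-1}]+1)(1+\tau)^{\tilde C_0}=0.$$
   Context: $(\Omega,\mathscr F,P)$ is a complete probability space with a filtration $\{\mathscr F_t\}_{t\ge0}$ satisfying the usual conditions, and $B(t)$ is a $d$-dimensional standard Brownian motion on it (with respect to this filtration). $C([-\tau,0];\mathbb{R}^n)$ is the space of continuous functions with norm $\|\phi\|=\sup_{-\tau\le\theta\le0}|\phi(\theta)|$; $C^b_{\mathscr F_0}([-\tau,0];\mathbb{R}^n)$ is the family of bounded, $\mathscr F_0$-measurable, $C([-\tau,0];\mathbb{R}^n)$-valued random variables. The initial value is $x_0=\xi=\{\xi(\theta),\theta\in[-\tau,0]\}\in C^b_{\mathscr F_0}([-\tau,0];\mathbb{R}^n)$, with $\mathbb{E}\|\xi\|^2<\infty$. $\delta\in C^1(\mathbb{R}_+,\mathbb{R}_+)$ with $\delta(0)=\tau$. The functions $f:\mathbb{R}^n\times\mathbb{R}^n\times[0,\infty)\to\mathbb{R}^n$ and $g:\mathbb{R}^n\times\mathbb{R}^n\times[0,\infty)\to\mathbb{R}^{n}\otimes\mathbb{R}^{d}$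 ($n\times d$ matrices) are Borel measurable, with $f(0,0,t)\equiv0$ and $g(0,0,t)\equiv0$. $|A|=\sqrt{\mathrm{trace}(A^{T}A)}$ for a matrix $A$; $a\vee b=\max\{a,b\}$, $a\wedge b=\min\{a,b\}$; $[x]$ is the integer part of $x$; $\log0=-\infty$. Truncation: for some $\Delta_0>0$, $h:(0,\Delta_0]\to(0,\infty)$ is a strictly positive decreasing function with $\lim_{\Delta\to0}h(\Delta)=\infty$, having an inverse function $h^{-1}$ with $h^{-1}(R)$ defined for all large $R$. For $\Delta\in(0,\Delta_0]$ put $$f_\Delta(x,y,t)=\begin{cases} f(x,y,t), & |x|\vee|y|\le h(\Delta),\\[2pt] \dfrac{|x|\vee|y|}{h(\Delta)}\,f\!\left(\dfrac{h(\Delta)}{|x|\vee|y|}x,\dfrac{h(\Delta)}{|x|\vee|y|}y,t\right), & |x|\vee|y|>h(\Delta),\end{cases}$$ and define $g_\Delta$ from $g$ in the same way. MTEM method: step sizes $\Delta\in(0,1)$ (in the domain of $h$) are always such that $\tau=m\Delta$ for a positive integer $m$; quantification over $\Delta\in(0,\Delta^*]$ is over such step sizes. Set $X_k^\Delta=\xi(k\Delta)$ for $k=-m,\dots,0$, and for $k=0,1,2,\dots$ $$X_{k+1}^\Delta=X_k^\Delta+f_\Delta\!\left(X_k^\Delta,X^\Delta_{k-[\delta(k\Delta)/\Delta]},k\Delta\right)\Delta+g_\Delta\!\left(X_k^\Delta,X^\Delta_{k-[\delta(k\Delta)/\Delta]},k\Delta\right)\Delta B_k,$$ where $\Delta B_k=B((k+1)\Delta)-B(k\Delta)$.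 Polynomial stability of the approximation: $X_k^\Delta$ is mean square polynomially stable if there exist $\Delta^*>0$ and $\gamma>0$ such that for any $0<\Delta\le\Delta^*$, $\limsup_{k\to\infty}\frac{\log\mathbb{E}(|X_k^\Delta|^2)}{\log(1+k\Delta)}<-\gamma$; it is almost surely polynomially stable if this is replaced by $\limsup_{k\to\infty}\frac{\log|X_k^\Delta|}{\log(1+k\Delta)}<-\gamma$ a.s. *)

theory Defs
  imports "HOL-Probability.Probability"
begin

text \<open>Only the $\sigma$-algebras of the measures \<open>F t\<close>, \<open>t \<ge> 0\<close>, are relevant; nothing is required
  of \<open>F t\<close> for \<open>t < 0\<close>.\<close>

definition usual_conditions :: "'a measure \<Rightarrow> (real \<Rightarrow> 'a measure) \<Rightarrow> bool" where
  "usual_conditions M F \<longleftrightarrow>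
     (\<forall>t\<ge>0. subalgebra M (F t)) \<and>
     (\<forall>s\<ge>0. \<forall>t\<ge>s. sets (F s) \<subseteq> sets (F t)) \<and>
     (\<forall>t\<ge>0. sets (F t) = (\<Inter>s\<in>{t<..}. sets (F s))) \<and>
     null_sets M \<subseteq> sets (F 0)"

definition brownian_motion ::
  "'a measure \<Rightarrow> (real \<Rightarrow> 'a measure) \<Rightarrow> (real \<Rightarrow> 'a \<Rightarrow> real ^ 'd) \<Rightarrow> bool" where
  "brownian_motion M F B \<longleftrightarrow>
     (\<forall>t\<ge>0. B t \<in> borel_measurable (F t)) \<and>
     (AE \<omega> in M. B 0 \<omega> = 0) \<and>
     (AE \<omega> in M. continuous_on {0..} (\<lambda>t. B t \<omega>)) \<and>
     (\<forall>s\<ge>0. \<forall>t>s.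
        prob_space.indep_set M (sets (F s))
          {(\<lambda>\<omega>. B t \<omega> - B s \<omega>) -` A \<inter> space M | A. A \<in> sets borel} \<and>
        prob_space.indep_vars M (\<lambda>_. borel) (\<lambda>i \<omega>. (B t \<omega> - B s \<omega>) $ i) UNIV \<and>
        (\<forall>i. distributed M lborel (\<lambda>\<omega>. (B t \<omega> - B s \<omega>) $ i) (normal_density 0 (sqrt (t - s)))))"

text \<open>\<open>C([-\<tau>,0]; E)\<close> with the supremum distance; its elements are extensional functions on
  \<open>{-\<tau>..0}\<close>.\<close>

definition C_space :: "real \<Rightarrow> (real \<Rightarrow> 'e::real_normed_vector) metric" where
  "C_space \<tau> = cfunspace (top_of_set {-\<tau>..0}) euclidean_metric"

definition C_borel :: "real \<Rightarrow> (real \<Rightarrow> 'e::real_normed_vector) measure" where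
  "C_borel \<tau> = sigma (mspace (C_space \<tau>)) {U. openin (mtopology_of (C_space \<tau>)) U}"

definition C_norm :: "real \<Rightarrow> (real \<Rightarrow> 'e::real_normed_vector) \<Rightarrow> real" where
  "C_norm \<tau> \<phi> = (SUP \<theta>\<in>{-\<tau>..0}. norm (\<phi> \<theta>))"

definition bounded_initial_segment ::
  "'a measure \<Rightarrow> 'a measure \<Rightarrow> real \<Rightarrow> ('a \<Rightarrow> real \<Rightarrow> 'e::real_normed_vector) \<Rightarrow> bool" where
  "bounded_initial_segment M F0 \<tau> \<xi> \<longleftrightarrow>
     \<xi> \<in> measurable F0 (C_borel \<tau>) \<and>
     (\<exists>b. \<forall>\<omega>\<in>space M. C_norm \<tau> (\<xi> \<omega>) \<le> b)"

definition frobenius_norm :: "real ^ 'd ^ 'n \<Rightarrow> real" where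
  "frobenius_norm A = sqrt (trace (transpose A ** A))"

lemma frobenius_norm_eq_norm: "frobenius_norm A = norm A"
proof -
  have "trace (transpose A ** A) = (\<Sum>j\<in>UNIV. \<Sum>i\<in>UNIV. (A $ i $ j)\<^sup>2)"
    by (simp add: trace_def matrix_matrix_mult_def transpose_def power2_eq_square)
  also have "\<dots> = (\<Sum>i\<in>UNIV. \<Sum>j\<in>UNIV. (A $ i $ j)\<^sup>2)"
    by (rule sum.swap)
  also have "\<dots> = (\<Sum>i\<in>UNIV. (norm (A $ i))\<^sup>2)"
    by (simp add: norm_vec_def L2_set_def sum_nonneg)
  finally show ?thesis
    by (simp add: frobenius_norm_def norm_vec_def[of A] L2_set_def)
qed

definition truncated ::
  "(real \<Rightarrow> real) \<Rightarrow> real \<Rightarrow> ('v \<Rightarrow> 'v \<Rightarrow> real \<Rightarrow> 'w) \<Rightarrow>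
   'v::real_normed_vector \<Rightarrow> 'v \<Rightarrow> real \<Rightarrow> 'w::real_vector" where
  "truncated h \<Delta> f x y t =
     (let r = max (norm x) (norm y) in
      if r \<le> h \<Delta> then f x y t
      else (r / h \<Delta>) *\<^sub>R f ((h \<Delta> / r) *\<^sub>R x) ((h \<Delta> / r) *\<^sub>R y) t)"

definition step_sizes :: "real \<Rightarrow> real \<Rightarrow> real set" where
  "step_sizes \<tau> \<Delta>0 =
     {\<Delta>. 0 < \<Delta> \<and> \<Delta> < 1 \<and> \<Delta> \<le> \<Delta>0 \<and> (\<exists>m::nat. m > 0 \<and> \<tau> = real m * \<Delta>)}"

text \<open>The recursion is on integer indices. Since \<open>0 \<le> \<delta> \<le> \<tau>\<close> in all uses, \<open>nat\<close> does not truncate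
  and no index below \<open>-m = -\<tau>/\<Delta>\<close> is reached; \<open>nat\<close> makes the recursion terminate for
  every \<open>\<delta>\<close>.\<close>

function mtem ::
  "(real ^ 'n \<Rightarrow> real ^ 'n \<Rightarrow> real \<Rightarrow> real ^ 'n) \<Rightarrow> (real ^ 'n \<Rightarrow> real ^ 'n \<Rightarrow> real \<Rightarrow> real ^ 'd ^ 'n) \<Rightarrow>
   (real \<Rightarrow> real) \<Rightarrow> (real \<Rightarrow> real) \<Rightarrow> ('a \<Rightarrow> real \<Rightarrow> real ^ 'n) \<Rightarrow> (real \<Rightarrow> 'a \<Rightarrow> real ^ 'd) \<Rightarrow>
   real \<Rightarrow> int \<Rightarrow> 'a \<Rightarrow> real ^ 'n" where
  "mtem f g \<delta> h \<xi> B \<Delta> k \<omega> =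
     (if k \<le> 0 then \<xi> \<omega> (of_int k * \<Delta>)
      else
        let j = k - 1;
            t = of_int j * \<Delta>;
            X = mtem f g \<delta> h \<xi> B \<Delta> j \<omega>;
            Y = mtem f g \<delta> h \<xi> B \<Delta> (j - int (nat \<lfloor>\<delta> t / \<Delta>\<rfloor>)) \<omega>
        in X + \<Delta> *\<^sub>R truncated h \<Delta> f X Y t
             + truncated h \<Delta> g X Y t *v (B (of_int k * \<Delta>) \<omega> - B t \<omega>))"
  by pat_completeness auto
termination
  by (relation "Wellfounded.measure (\<lambda>(f, g, \<delta>, h, \<xi>, B, \<Delta>, k, \<omega>). nat k)") (auto, linarith)

declare mtem.simps [simp del]

definition elog :: "ennreal \<Rightarrow> ereal" where
  "elog x = (if x = 0 then -\<infinity> else if x = \<infinity> then \<infinity> else ereal (ln (enn2real x)))"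

text \<open>Expectations of nonnegative quantities are taken as \<open>nn_integral\<close>, so that an infinite second
  moment counts as \<open>\<infinity>\<close>. The quotients at \<open>k = 0\<close>, with denominator \<open>ln 1\<close>, do not affect the
  limits superior.\<close>

definition as_log_rate :: "real \<Rightarrow> (int \<Rightarrow> 'a \<Rightarrow> 'e::real_normed_vector) \<Rightarrow> 'a \<Rightarrow> ereal" where
  "as_log_rate \<Delta> X \<omega> =
     limsup (\<lambda>k. elog (ennreal (norm (X (int k) \<omega>))) / ereal (ln (1 + real k * \<Delta>)))"

definition ms_log_rate :: "'a measure \<Rightarrow> real \<Rightarrow> (int \<Rightarrow> 'a \<Rightarrow> 'e::real_normed_vector) \<Rightarrow> ereal" where
  "ms_log_rate M \<Delta> X =
     limsup (\<lambda>k. elog (\<integral>\<^sup>+\<omega>. ennreal ((norm (X (int k) \<omega>))\<^sup>2) \<partial>M) / ereal (ln (1 + real k * \<Delta>)))"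

definition as_polynomially_stable ::
  "'a measure \<Rightarrow> real set \<Rightarrow> (real \<Rightarrow> int \<Rightarrow> 'a \<Rightarrow> 'e::real_normed_vector) \<Rightarrow> bool" where
  "as_polynomially_stable M S X \<longleftrightarrow>
     (\<exists>\<Delta>s>0. \<exists>\<gamma>>0. \<forall>\<Delta>\<in>S. \<Delta> \<le> \<Delta>s \<longrightarrow> (AE \<omega> in M. as_log_rate \<Delta> (X \<Delta>) \<omega> < ereal (- \<gamma>)))"

definition ms_polynomially_stable ::
  "'a measure \<Rightarrow> real set \<Rightarrow> (real \<Rightarrow> int \<Rightarrow> 'a \<Rightarrow> 'e::real_normed_vector) \<Rightarrow> bool" where
  "ms_polynomially_stable M S X \<longleftrightarrow>
     (\<exists>\<Delta>s>0. \<exists>\<gamma>>0. \<forall>\<Delta>\<in>S. \<Delta> \<le> \<Delta>s \<longrightarrow> ms_log_rate M \<Delta> (X \<Delta>) < ereal (- \<gamma>))"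

end

theory Submission
  imports Defs
begin

text \<open>Put \<open>V k = (1 + k \<Delta>) powr C * \<bar>X k\<bar>\<^sup>2\<close>. The Khasminskii-type condition survives truncation up to
  an arbitrarily small change of its constants, so that \<open>V (k+1) - V k\<close> is bounded by a dissipative
  term, a delayed term, a summable term and a martingale difference. The delay map hits every index
  at most \<open>\<lfloor>1 / (1 - \<eta>)\<rfloor> + 1\<close> times, which lets the dissipative terms absorb the delayed ones after
  summation whenever \<open>C \<le> C0\<close>. Hence \<open>V n \<le> Z + S n\<close> pathwise, with a constant \<open>Z\<close> and a
  martingale \<open>S\<close> starting at \<open>0\<close>. Expectations give the mean square rate; the almost sure rate
  follows because the nonnegative martingale \<open>Z + S\<close> has bounded paths by the maximal inequality.\<close>

section \<open>Truncated coefficients\<close>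

text \<open>The obstacle is the term
  \<open>\<Delta>\<^sup>2 * (norm (drift k \<omega>))\<^sup>2\<close> of the explicit scheme:
  condition (iii) does not control the drift alone, and the Lipschitz constant on the ball of radius
  \<open>h \<Delta>\<close> may grow without bound as the step shrinks. Condition (v), read at R =
  \<open>h \<Delta>\<close>, makes (1 + t) L^2 \<open>\<Delta>\<close> small uniformly in t, so this
  term also carries the factor 1 / (1 + t) and can be charged to the dissipation. Half of
  \<open>\<epsilon>\<close> pays for it, the other half for the change that truncation makes to the
  inhomogeneous term. The equation for \<open>C0\<close> is the break-even point of three effects: C
  from the growth of the weight, lam1 - \<open>\<epsilon>\<close> from dissipation, and lam2 +
  \<open>\<epsilon>\<close> from the delay, multiplied by the size of a fibre of the delay map and
  by (1 + \<open>\<tau>\<close>)^C, a bound for the ratio of weights across one delay. The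
  restriction C < lam0 comes from summability of the inhomogeneous term. The constant Z is the same
  for all paths because the initial segment is bounded and the remaining contributions are
  deterministic; this lets one pathwise inequality yield both rates.\<close>

text \<open>Outside the ball, truncation extends the coefficient along rays homogeneously of degree
  one. The bound is homogeneous of the same degree, so it spreads from the ball to the whole space
  with the same constant.\<close>

lemma norm_truncated_le:
  fixes f :: "'v::real_normed_vector \<Rightarrow> 'v \<Rightarrow> real \<Rightarrow> 'w::real_normed_vector"
  assumes h: "h \<Delta> > 0"
    and f: "\<And>x y. max (norm x) (norm y) \<le> h \<Delta> \<Longrightarrow> norm (f x y t) \<le> l * (norm x + norm y)"
  shows "norm (truncated h \<Delta> f x y t) \<le> l * (norm x + norm y)"
proof -
  define r where "r = max (norm x) (norm y)"
  show ?thesis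
  proof (cases "r \<le> h \<Delta>")
    case True
    then show ?thesis
      using f by (simp add: truncated_def r_def)
  next
    case False
    then have r: "r > 0"
      using h by linarith
    define c where "c = h \<Delta> / r"
    have c: "c > 0" "c * r = h \<Delta>"
      using h r by (auto simp: c_def)
    have "c * norm x \<le> c * r" "c * norm y \<le> c * r"
      using c(1) by (simp_all add: r_def)
    then have "norm (f (c *\<^sub>R x) (c *\<^sub>R y) t) \<le> l * (norm (c *\<^sub>R x) + norm (c *\<^sub>R y))"
      using c by (intro f) auto
    then have "norm (f (c *\<^sub>R x) (c *\<^sub>R y) t) \<le> c * (l * (norm x + norm y))"
      using c by (simp add: algebra_simps)
    moreover have "truncated h \<Delta> f x y t = (1 / c) *\<^sub>R f (c *\<^sub>R x) (c *\<^sub>R y) t"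
      using False h r by (simp add: truncated_def r_def[symmetric] c_def Let_def)
    ultimately show ?thesis
      using c by (simp add: field_simps)
  qed
qed

text \<open>Rescaling multiplies the left-hand side by \<open>(r / h \<Delta>)\<^sup>2\<close> with \<open>r = max \<bar>x\<bar> \<bar>y\<bar>\<close>; only the
  inhomogeneous term \<open>\<kappa>\<close> is affected, and \<open>r\<^sup>2 \<le> \<bar>x\<bar>\<^sup>2 + \<bar>y\<bar>\<^sup>2\<close>.\<close>

lemma truncated_khasminskii:
  fixes f :: "'v::real_inner \<Rightarrow> 'v \<Rightarrow> real \<Rightarrow> 'v"
    and g :: "'v \<Rightarrow> 'v \<Rightarrow> real \<Rightarrow> 'w::real_normed_vector"
  assumes h: "h \<Delta> > 0" and \<kappa>: "\<kappa> \<ge> 0" and t: "t \<ge> 0"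
    and fg: "\<And>x y. 2 * (x \<bullet> f x y t) + (norm (g x y t))\<^sup>2
               \<le> (\<kappa> - p * (norm x)\<^sup>2 + q * (norm y)\<^sup>2) / (1 + t)"
  shows "2 * (x \<bullet> truncated h \<Delta> f x y t) + (norm (truncated h \<Delta> g x y t))\<^sup>2
    \<le> (\<kappa> - (p - \<kappa> / (h \<Delta>)\<^sup>2) * (norm x)\<^sup>2 + (q + \<kappa> / (h \<Delta>)\<^sup>2) * (norm y)\<^sup>2) / (1 + t)"
proof -
  define r where "r = max (norm x) (norm y)"
  have r2: "r\<^sup>2 \<le> (norm x)\<^sup>2 + (norm y)\<^sup>2"
    by (simp add: r_def max_def)
  show ?thesis
  proof (cases "r \<le> h \<Delta>")
    case True
    then have eq: "truncated h \<Delta> f x y t = f x y t" "truncated h \<Delta> g x y t = g x y t"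
      by (simp_all add: truncated_def r_def)
    have "0 \<le> \<kappa> / (h \<Delta>)\<^sup>2 * ((norm x)\<^sup>2 + (norm y)\<^sup>2)"
      using \<kappa> by simp
    then have "\<kappa> - p * (norm x)\<^sup>2 + q * (norm y)\<^sup>2
        \<le> \<kappa> - (p - \<kappa> / (h \<Delta>)\<^sup>2) * (norm x)\<^sup>2 + (q + \<kappa> / (h \<Delta>)\<^sup>2) * (norm y)\<^sup>2"
      by (simp add: algebra_simps)
    then have "(\<kappa> - p * (norm x)\<^sup>2 + q * (norm y)\<^sup>2) / (1 + t)
        \<le> (\<kappa> - (p - \<kappa> / (h \<Delta>)\<^sup>2) * (norm x)\<^sup>2 + (q + \<kappa> / (h \<Delta>)\<^sup>2) * (norm y)\<^sup>2) / (1 + t)"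
      using t by (intro divide_right_mono) auto
    with fg[of x y] show ?thesis
      unfolding eq by linarith
  next
    case False
    then have r: "r > 0"
      using h by linarith
    define c where "c = h \<Delta> / r"
    have c: "c > 0"
      using h r by (auto simp: c_def)
    have eq: "truncated h \<Delta> f x y t = (1 / c) *\<^sub>R f (c *\<^sub>R x) (c *\<^sub>R y) t"
        "truncated h \<Delta> g x y t = (1 / c) *\<^sub>R g (c *\<^sub>R x) (c *\<^sub>R y) t"
      using False h r by (simp_all add: truncated_def r_def[symmetric] c_def Let_def)
    have "2 * (x \<bullet> truncated h \<Delta> f x y t) + (norm (truncated h \<Delta> g x y t))\<^sup>2
        = (2 * ((c *\<^sub>R x) \<bullet> f (c *\<^sub>R x) (c *\<^sub>R y) t) + (norm (g (c *\<^sub>R x) (c *\<^sub>R y) t))\<^sup>2) / c\<^sup>2"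
      unfolding eq using c by (simp add: field_simps power2_eq_square)
    also have "\<dots> \<le> ((\<kappa> - p * (norm (c *\<^sub>R x))\<^sup>2 + q * (norm (c *\<^sub>R y))\<^sup>2) / (1 + t)) / c\<^sup>2"
      using c by (intro divide_right_mono fg) auto
    also have "\<dots> = (\<kappa> / c\<^sup>2 - p * (norm x)\<^sup>2 + q * (norm y)\<^sup>2) / (1 + t)"
      using c t by (simp add: field_simps)
    also have "\<kappa> / c\<^sup>2 = \<kappa> / (h \<Delta>)\<^sup>2 * r\<^sup>2"
      using r h by (simp add: c_def power_divide)
    also have "(\<kappa> / (h \<Delta>)\<^sup>2 * r\<^sup>2 - p * (norm x)\<^sup>2 + q * (norm y)\<^sup>2) / (1 + t)
       \<le> (\<kappa> / (h \<Delta>)\<^sup>2 * ((norm x)\<^sup>2 + (norm y)\<^sup>2) - p * (norm x)\<^sup>2 + q * (norm y)\<^sup>2) / (1 + t)"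
      using t \<kappa> r2 by (intro divide_right_mono add_right_mono diff_right_mono mult_left_mono) auto
    also have "\<dots> \<le> (\<kappa> - (p - \<kappa> / (h \<Delta>)\<^sup>2) * (norm x)\<^sup>2 + (q + \<kappa> / (h \<Delta>)\<^sup>2) * (norm y)\<^sup>2) / (1 + t)"
      using t \<kappa> by (intro divide_right_mono) (auto simp: algebra_simps)
    finally show ?thesis .
  qed
qed

text \<open>Both errors have the form \<open>\<epsilon> / 2 * s / (1 + t)\<close>: one comes from
  truncation, the other from the squared drift. The factor 2 in the second smallness condition is
  that of (a + b)^2 <= 2 (a^2 + b^2).\<close>

lemma truncated_step_estimate:
  fixes f :: "'v::real_inner \<Rightarrow> 'v \<Rightarrow> real \<Rightarrow> 'v"
    and g :: "'v \<Rightarrow> 'v \<Rightarrow> real \<Rightarrow> 'w::real_normed_vector"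
  assumes h: "h \<Delta> > 0" and \<Delta>: "\<Delta> > 0" and t: "t \<ge> 0" and \<kappa>: "\<kappa> \<ge> 0"
    and small: "\<kappa> / (h \<Delta>)\<^sup>2 \<le> \<epsilon> / 2" "2 * ((1 + t) * l\<^sup>2 * \<Delta>) \<le> \<epsilon> / 2"
    and f: "norm (truncated h \<Delta> f x y t) \<le> l * (norm x + norm y)"
    and fg: "\<And>x y. 2 * (x \<bullet> f x y t) + (norm (g x y t))\<^sup>2
               \<le> (\<kappa> - p * (norm x)\<^sup>2 + q * (norm y)\<^sup>2) / (1 + t)"
  shows "\<Delta> * (2 * (x \<bullet> truncated h \<Delta> f x y t) + (norm (truncated h \<Delta> g x y t))\<^sup>2)
      + \<Delta>\<^sup>2 * (norm (truncated h \<Delta> f x y t))\<^sup>2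
    \<le> \<Delta> * ((\<kappa> - (p - \<epsilon>) * (norm x)\<^sup>2 + (q + \<epsilon>) * (norm y)\<^sup>2) / (1 + t))"
proof -
  define s where "s = (norm x)\<^sup>2 + (norm y)\<^sup>2"
  have s: "s \<ge> 0"
    by (simp add: s_def)
  have "(norm (truncated h \<Delta> f x y t))\<^sup>2 \<le> (l * (norm x + norm y))\<^sup>2"
    using f by (intro power_mono) auto
  also have "\<dots> \<le> l\<^sup>2 * (2 * s)"
    unfolding power_mult_distrib s_def
    using zero_le_power2[of "norm x - norm y"]
    by (intro mult_left_mono) (auto simp: power2_sum power2_diff)
  finally have "\<Delta> * (norm (truncated h \<Delta> f x y t))\<^sup>2 \<le> \<Delta> * (l\<^sup>2 * (2 * s))"
    using \<Delta> by (intro mult_left_mono) auto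
  also have "\<dots> = 2 * ((1 + t) * l\<^sup>2 * \<Delta>) * s / (1 + t)"
    using t by (simp add: field_simps)
  also have "\<dots> \<le> \<epsilon> / 2 * s / (1 + t)"
    using t s small by (intro divide_right_mono mult_right_mono) auto
  finally have 1: "\<Delta> * (norm (truncated h \<Delta> f x y t))\<^sup>2 \<le> \<epsilon> / 2 * s / (1 + t)" .
  have "2 * (x \<bullet> truncated h \<Delta> f x y t) + (norm (truncated h \<Delta> g x y t))\<^sup>2
     \<le> (\<kappa> - (p - \<kappa> / (h \<Delta>)\<^sup>2) * (norm x)\<^sup>2 + (q + \<kappa> / (h \<Delta>)\<^sup>2) * (norm y)\<^sup>2) / (1 + t)"
    by (rule truncated_khasminskii[where h = h and \<Delta> = \<Delta>, OF h \<kappa> t]) (rule fg)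
  also have "\<dots> = (\<kappa> - p * (norm x)\<^sup>2 + q * (norm y)\<^sup>2 + \<kappa> / (h \<Delta>)\<^sup>2 * s) / (1 + t)"
    by (simp add: s_def algebra_simps)
  also have "\<dots> \<le> (\<kappa> - p * (norm x)\<^sup>2 + q * (norm y)\<^sup>2 + \<epsilon> / 2 * s) / (1 + t)"
    using t s small by (intro divide_right_mono add_left_mono mult_right_mono) auto
  finally have "2 * (x \<bullet> truncated h \<Delta> f x y t) + (norm (truncated h \<Delta> g x y t))\<^sup>2
      + \<Delta> * (norm (truncated h \<Delta> f x y t))\<^sup>2
      \<le> (\<kappa> - p * (norm x)\<^sup>2 + q * (norm y)\<^sup>2 + \<epsilon> / 2 * s) / (1 + t) + \<epsilon> / 2 * s / (1 + t)"
    using 1 by linarith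
  also have "\<dots> = (\<kappa> - (p - \<epsilon>) * (norm x)\<^sup>2 + (q + \<epsilon>) * (norm y)\<^sup>2) / (1 + t)"
    unfolding add_divide_distrib[symmetric]
    by (rule arg_cong[where f = "\<lambda>z. z / (1 + t)"]) (simp add: s_def field_simps)
  finally have "\<Delta> * (2 * (x \<bullet> truncated h \<Delta> f x y t) + (norm (truncated h \<Delta> g x y t))\<^sup>2
      + \<Delta> * (norm (truncated h \<Delta> f x y t))\<^sup>2)
      \<le> \<Delta> * ((\<kappa> - (p - \<epsilon>) * (norm x)\<^sup>2 + (q + \<epsilon>) * (norm y)\<^sup>2) / (1 + t))"
    using \<Delta> by (intro mult_left_mono) auto
  then show ?thesis
    by (simp add: algebra_simps power2_eq_square)
qed

section \<open>The deterministic delay inequality\<close>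

text \<open>This is 1 - exp(-z) <= z with z = c ln(b / a), followed by ln(b / a) <= b / a - 1. The
  right end b carries the weight because all other terms of the recursion are multiplied by the new
  weight too.\<close>

lemma powr_diff_le:
  fixes a b c :: real
  assumes "0 < a" "a \<le> b" "0 \<le> c"
  shows "b powr c - a powr c \<le> c * ((b - a) / a) * b powr c"
proof -
  have "1 + c * ln (a / b) \<le> exp (c * ln (a / b))"
    by simp
  also have "exp (c * ln (a / b)) = (a / b) powr c"
    using assms by (simp add: powr_def)
  finally have "1 - (a / b) powr c \<le> c * ln (b / a)"
    using assms by (simp add: ln_div algebra_simps)
  also have "\<dots> \<le> c * (b / a - 1)"
    using assms by (intro mult_left_mono ln_le_minus_one) auto
  finally have "(1 - (a / b) powr c) * b powr c \<le> c * (b / a - 1) * b powr c"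
    by (intro mult_right_mono) auto
  moreover have "(1 - (a / b) powr c) * b powr c = b powr c - a powr c"
    using assms by (simp add: powr_divide field_simps)
  moreover have "b / a - 1 = (b - a) / a"
    using assms by (simp add: field_simps)
  ultimately show ?thesis by simp
qed

text \<open>The left-hand side is strictly increasing in c, equals b - a < 0 at c = 0 and is
  positive at c = a. It serves for b = (lam2 + \<open>\<epsilon>\<close>) N, a = lam1 -
  \<open>\<epsilon>\<close> and u = 1 + \<open>\<tau>\<close>.\<close>

lemma ex1_root_affine_plus_exponential:
  fixes a b u :: real
  assumes "b > 0" "u \<ge> 1" "b < a"
  shows "\<exists>c0. {c. c > 0 \<and> c - a + b * u powr c = 0} = {c0}"
proof -
  define F where "F c = c - a + b * u powr c" for c
  have mono: "F x < F y" if "x < y" for x y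
    using that assms powr_mono[of x y u] mult_left_mono[of "u powr x" "u powr y" b]
    unfolding F_def by linarith
  have "F 0 < 0" "0 < F a"
    using assms by (auto simp: F_def)
  moreover have "continuous_on {0..a} F"
    unfolding F_def using assms by (intro continuous_intros) auto
  ultimately obtain c where c: "0 \<le> c" "c \<le> a" "F c = 0"
    using IVT'[of F 0 0 a] assms by auto
  have "c > 0"
    using c \<open>F 0 < 0\<close> by (cases "c = 0") auto
  moreover have "c' = c" if "F c' = 0" for c'
    using mono[of c c'] mono[of c' c] c(3) that by (cases c c' rule: linorder_cases) auto
  ultimately have "{c. c > 0 \<and> F c = 0} = {c}"
    using c(3) by blast
  then show ?thesis
    unfolding F_def by blast
qed

text \<open>The map t - \<open>\<delta> t\<close> increases with slope at least 1 -
  \<open>\<eta>\<close>, and the floor loses less than one grid step. Hence two indices of one fibre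
  differ by less than 1 / (1 - \<open>\<eta>\<close>), and the fibre lies in a window of
  \<open>u + 1\<close> integers starting at its minimum.\<close>

lemma card_delay_fibre_le:
  fixes \<delta> :: "real \<Rightarrow> real" and j :: int
  assumes \<Delta>: "\<Delta> > 0" and \<eta>: "\<eta> < 1"
    and lip: "\<And>s t. 0 \<le> s \<Longrightarrow> s \<le> t \<Longrightarrow> \<delta> t - \<delta> s \<le> \<eta> * (t - s)"
  shows "real (card {k\<in>{..<n}. int k - \<lfloor>\<delta> (real k * \<Delta>) / \<Delta>\<rfloor> = j}) \<le> real_of_int \<lfloor>inverse (1 - \<eta>)\<rfloor> + 1"
proof -
  define u where "u = \<lfloor>inverse (1 - \<eta>)\<rfloor>"
  define A where "A = {k\<in>{..<n}. int k - \<lfloor>\<delta> (real k * \<Delta>) / \<Delta>\<rfloor> = j}"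
  have u0: "u \<ge> 0"
    using \<eta> by (simp add: u_def)
  have close: "int l - int k \<le> u" if "k \<in> A" "l \<in> A" "k \<le> l" for k l
  proof -
    have "real l - \<delta> (real l * \<Delta>) / \<Delta> \<le> real_of_int j" "real_of_int j < real k - \<delta> (real k * \<Delta>) / \<Delta> + 1"
      using that by (auto simp: A_def) linarith+
    then have "real l - real k < 1 + (\<delta> (real l * \<Delta>) - \<delta> (real k * \<Delta>)) / \<Delta>"
      by (simp add: diff_divide_distrib)
    also have "\<dots> \<le> 1 + \<eta> * (real l * \<Delta> - real k * \<Delta>) / \<Delta>"
      using that \<Delta> by (intro add_left_mono divide_right_mono lip) auto
    also have "\<dots> = 1 + \<eta> * (real l - real k)"
      using \<Delta> by (simp add: field_simps)
    finally have "(1 - \<eta>) * (real l - real k) < 1"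
      by (simp add: algebra_simps)
    then have "real l - real k < inverse (1 - \<eta>)"
      using \<eta> by (simp add: field_simps)
    then show ?thesis
      unfolding u_def by linarith
  qed
  show ?thesis
  proof (cases "A = {}")
    case True
    then show ?thesis
      using u0 unfolding A_def[symmetric] u_def[symmetric] by simp
  next
    case False
    have fin: "finite A"
      by (simp add: A_def)
    define k0 where "k0 = Min A"
    have k0: "k0 \<in> A" "\<And>l. l \<in> A \<Longrightarrow> k0 \<le> l"
      using fin False by (auto simp: k0_def)
    have "A \<subseteq> {k0..k0 + nat u}"
      using close[OF k0(1)] k0(2) u0 by fastforce
    then have "card A \<le> card {k0..k0 + nat u}"
      by (intro card_mono) auto
    then have "real (card A) \<le> real (nat u + 1)"
      by simp
    then show ?thesis
      using u0 unfolding A_def[symmetric] u_def[symmetric] by simp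
  qed
qed

text \<open>Comparison with the p-series through 1 + k \<open>\<Delta>\<close> >=
  \<open>\<Delta>\<close> (k + 1), where \<open>\<Delta> < 1\<close> enters.\<close>

lemma summable_powr_grid:
  assumes "0 < \<Delta>" "\<Delta> < 1" "p > 1"
  shows "summable (\<lambda>k. (1 + real k * \<Delta>) powr (- p))"
proof (rule summable_comparison_test')
  have "summable (\<lambda>k. real k powr (- p))"
    using assms by (simp add: summable_real_powr_iff)
  then have "summable (\<lambda>k. real (Suc k) powr (- p))"
    by (subst summable_Suc_iff)
  then show "summable (\<lambda>k. \<Delta> powr (- p) * real (Suc k) powr (- p))"
    by (rule summable_mult)
  fix k :: nat
  have "norm ((1 + real k * \<Delta>) powr (- p)) \<le> (\<Delta> * real (Suc k)) powr (- p)"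
    using assms by (auto intro!: powr_mono2' simp: algebra_simps add_pos_nonneg)
  then show "norm ((1 + real k * \<Delta>) powr (- p)) \<le> \<Delta> powr (- p) * real (Suc k) powr (- p)"
    using assms by (simp add: powr_mult)
qed

text \<open>With the weight \<open>w k = (1 + k \<Delta>) powr C\<close> one has \<open>w (k+1) - w k \<le> C \<Delta> w (k+1) / (1 + k \<Delta>)\<close>, so
  that every term of the recursion carries the same factor \<open>r k = \<Delta> w (k+1) / (1 + k \<Delta>)\<close>. As
  \<open>r k \<le> (1 + \<tau>) powr C * r (\<phi> k)\<close> and \<open>\<phi>\<close> is at most \<open>N\<close>-to-one, the delayed terms are absorbed
  by the dissipative ones, up to the contribution of the initial segment.\<close>

lemma weighted_delay_inequality:
  fixes \<phi> :: "nat \<Rightarrow> int"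
  assumes \<Delta>: "0 < \<Delta>" "\<Delta> < 1" and \<tau>: "\<tau> = real m * \<Delta>"
    and C: "0 < C" "C < lam" and K: "K \<ge> 0" and q: "q \<ge> 0"
    and \<phi>: "\<And>k. \<phi> k \<le> int k" "\<And>k. int k - int m \<le> \<phi> k"
    and fibre: "\<And>n j. real (card {k\<in>{..<n}. \<phi> k = j}) \<le> N"
    and neg: "C - p + q * N * (1 + \<tau>) powr C \<le> 0"
  shows "\<exists>Z. \<forall>(a :: int \<Rightarrow> real) \<zeta> n. (\<forall>k. a k \<ge> 0) \<longrightarrow> (\<forall>k. - int m \<le> k \<and> k \<le> 0 \<longrightarrow> a k \<le> b) \<longrightarrow>
     (\<forall>k::nat. a (int k + 1) \<le> a (int k) + \<Delta> * ((K * (1 + real k * \<Delta>) powr (- lam)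
        - p * a (int k) + q * a (\<phi> k)) / (1 + real k * \<Delta>)) + \<zeta> k) \<longrightarrow>
     (1 + real n * \<Delta>) powr C * a (int n) \<le> Z + (\<Sum>k<n. (1 + real (Suc k) * \<Delta>) powr C * \<zeta> k)"
proof -
  define w where "w k = (1 + real k * \<Delta>) powr C" for k
  define r where "r k = \<Delta> * w (Suc k) / (1 + real k * \<Delta>)" for k
  have pos: "1 + real k * \<Delta> > 0" for k
    using \<Delta> by (simp add: add_pos_nonneg)
  have w: "w k > 0" for k
    using pos[of k] by (simp add: w_def)
  have r: "r k > 0" for k
    using \<Delta> w[of "Suc k"] pos[of k] by (simp add: r_def)
  have w_step: "w (Suc k) - w k \<le> C * r k" for k
    using powr_diff_le[of "1 + real k * \<Delta>" "1 + real (Suc k) * \<Delta>" C] pos[of k] \<Delta> C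
    by (simp add: w_def r_def algebra_simps)
  define s where "s k = K * (r k * (1 + real k * \<Delta>) powr (- lam))" for k
  have s0: "s k \<ge> 0" for k
    using K r[of k] by (simp add: s_def)
  \<comment> \<open>Since \<open>\<Delta> < 1\<close>, consecutive weights differ by a factor of at
    most 2^C, so \<open>s k\<close> is of order (1 + k \<open>\<Delta>\<close>)^(-(1 + lam - C)).
    The exponent exceeds 1 exactly because C < lam.\<close>
  have "summable s"
    unfolding s_def
  proof (intro summable_mult, rule summable_comparison_test')
    show "summable (\<lambda>k. 2 powr C * (1 + real k * \<Delta>) powr (- (1 + lam - C)))"
      using \<Delta> C by (intro summable_mult summable_powr_grid) auto
    fix k :: nat
    have "w (Suc k) \<le> (2 * (1 + real k * \<Delta>)) powr C"
      unfolding w_def using \<Delta> C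
      by (intro powr_mono2) (auto simp: algebra_simps add_increasing2)
    also have "\<dots> = 2 powr C * (1 + real k * \<Delta>) powr C"
      using pos[of k] by (subst powr_mult) auto
    finally have "1 * (w (Suc k) * (1 + real k * \<Delta>) powr (- 1) * (1 + real k * \<Delta>) powr (- lam)) \<le>
        1 * (2 powr C * (1 + real k * \<Delta>) powr C * (1 + real k * \<Delta>) powr (- 1) * (1 + real k * \<Delta>) powr (- lam))"
      by (intro mult_left_mono mult_right_mono) auto
    also have "\<dots> = 2 powr C * (1 + real k * \<Delta>) powr (- (1 + lam - C))"
    proof -
      have "- (1 + lam - C) = C + (- 1) + (- lam)"
        by simp
      then show ?thesis
        by (simp only: powr_add mult.assoc mult_1)
    qed
    finally have *: "w (Suc k) * (1 + real k * \<Delta>) powr (- 1) * (1 + real k * \<Delta>) powr (- lam)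
        \<le> 2 powr C * (1 + real k * \<Delta>) powr (- (1 + lam - C))"
      by simp
    have "r k * (1 + real k * \<Delta>) powr (- lam) = \<Delta> * (w (Suc k) * (1 + real k * \<Delta>) powr (- 1) * (1 + real k * \<Delta>) powr (- lam))"
      using pos[of k] by (simp add: r_def powr_minus_divide)
    also have "\<dots> \<le> 1 * (w (Suc k) * (1 + real k * \<Delta>) powr (- 1) * (1 + real k * \<Delta>) powr (- lam))"
      using \<Delta> w[of "Suc k"] by (intro mult_right_mono) auto
    finally show "norm (r k * (1 + real k * \<Delta>) powr (- lam)) \<le> 2 powr C * (1 + real k * \<Delta>) powr (- (1 + lam - C))"
      using * r[of k] by simp
  qed
  \<comment> \<open>The constant is fixed before \<open>a\<close> and \<open>\<zeta>\<close> are
    chosen, since it has to serve every path. Its last summand pays for the delayed terms that look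
    into the initial segment.\<close>
  define Z where "Z = b + suminf s + q * (\<Sum>k<m. r k * b)"
  \<comment> \<open>The two times differ by at most m \<open>\<Delta>\<close> =
    \<open>\<tau>\<close>, and 1 + t + \<open>\<tau>\<close> <= (1 + \<open>\<tau>\<close>) (1 + t);
    this is the origin of the factor (1 + \<open>\<tau>\<close>)^C. The denominators compare because
    j <= k.\<close>
  have r_delay: "r k \<le> (1 + \<tau>) powr C * r j" if "int j = \<phi> k" for j k
  proof -
    have j: "real j \<le> real k" "real k \<le> real j + real m"
      using \<phi>[of k] that by linarith+
    have "1 + real (Suc k) * \<Delta> \<le> 1 + (real (Suc j) + real m) * \<Delta>"
      using j \<Delta> by (intro add_left_mono mult_right_mono) auto
    also have "\<dots> \<le> (1 + \<tau>) * (1 + real (Suc j) * \<Delta>)"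
      using \<Delta> by (simp add: \<tau> algebra_simps)
    finally have "w (Suc k) \<le> ((1 + \<tau>) * (1 + real (Suc j) * \<Delta>)) powr C"
      unfolding w_def using C pos[of "Suc k"] by (intro powr_mono2) auto
    also have "\<dots> = (1 + \<tau>) powr C * w (Suc j)"
      unfolding w_def using \<tau> \<Delta> pos[of "Suc j"] by (subst powr_mult) auto
    finally have "w (Suc k) / (1 + real k * \<Delta>) \<le> (1 + \<tau>) powr C * w (Suc j) / (1 + real j * \<Delta>)" (is "?l \<le> ?r")
      using j \<Delta> w[of "Suc j"] pos[of j] w[of "Suc k"]
      by (intro frac_le) (auto intro: mult_right_mono less_imp_le)
    then have "\<Delta> * ?l \<le> \<Delta> * ?r"
      using \<Delta> by (intro mult_left_mono) auto
    then show ?thesis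
      by (simp add: r_def mult_ac)
  qed
  have "(1 + real n * \<Delta>) powr C * a (int n) \<le> Z + (\<Sum>k<n. (1 + real (Suc k) * \<Delta>) powr C * \<zeta> k)"
    if a0: "\<And>k. a k \<ge> 0" and ab: "\<And>k. - int m \<le> k \<Longrightarrow> k \<le> 0 \<Longrightarrow> a k \<le> b"
      and rec: "\<And>k::nat. a (int k + 1) \<le> a (int k) + \<Delta> * ((K * (1 + real k * \<Delta>) powr (- lam) - p * a (int k) + q * a (\<phi> k)) / (1 + real k * \<Delta>)) + \<zeta> k"
    for a :: "int \<Rightarrow> real" and \<zeta> n
  proof -
    have b: "b \<ge> 0"
      using a0[of 0] ab[of 0] by simp
    have step: "w (Suc k) * a (int (Suc k)) \<le> w k * a (int k) +
        (s k + (C - p) * (r k * a (int k)) + q * (r k * a (\<phi> k)) + w (Suc k) * \<zeta> k)" for k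
    proof -
      have "w (Suc k) * a (int (Suc k)) \<le> w (Suc k) *
          (a (int k) + \<Delta> * ((K * (1 + real k * \<Delta>) powr (- lam) - p * a (int k) + q * a (\<phi> k)) / (1 + real k * \<Delta>)) + \<zeta> k)"
        using rec[of k] w[of "Suc k"] by (intro mult_left_mono) (auto simp: add.commute)
      also have "\<dots> = w (Suc k) * a (int k) + s k - p * (r k * a (int k)) + q * (r k * a (\<phi> k)) + w (Suc k) * \<zeta> k"
        by (simp add: s_def r_def algebra_simps add_divide_distrib diff_divide_distrib)
      also have "w (Suc k) * a (int k) \<le> (w k + C * r k) * a (int k)"
        using w_step[of k] a0 by (intro mult_right_mono) auto
      finally show ?thesis
        by (simp add: algebra_simps)
    qed
    have "w n * a (int n) \<le> a 0 +
        (\<Sum>k<n. s k + (C - p) * (r k * a (int k)) + q * (r k * a (\<phi> k)) + w (Suc k) * \<zeta> k)" for n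
    proof (induction n)
      case 0
      then show ?case by (simp add: w_def)
    next
      case (Suc n)
      then show ?case using step[of n] by simp
    qed
    then have *: "w n * a (int n) \<le> a 0 + (\<Sum>k<n. s k) + (C - p) * (\<Sum>k<n. r k * a (int k)) +
        q * (\<Sum>k<n. r k * a (\<phi> k)) + (\<Sum>k<n. w (Suc k) * \<zeta> k)"
      unfolding sum.distrib sum_distrib_left[symmetric] by (simp only: add.assoc)
    have "(\<Sum>k<n. r k * a (\<phi> k)) \<le> (\<Sum>k<m. r k * b) + N * ((1 + \<tau>) powr C * (\<Sum>j<n. r j * a (int j)))"
    proof -
      \<comment> \<open>Outside \<open>I\<close> the lagged index is negative, which forces k < m
        and \<open>a (\<phi> k) \<le> b\<close>. Inside \<open>I\<close> the delayed terms are
        regrouped by their lagged index.\<close>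
      define I where "I = {k\<in>{..<n}. \<phi> k \<ge> 0}"
      have "(\<Sum>k<n. r k * a (\<phi> k)) = (\<Sum>k\<in>{..<n} - I. r k * a (\<phi> k)) + (\<Sum>k\<in>I. r k * a (\<phi> k))"
        by (intro sum.subset_diff) (auto simp: I_def)
      also have "(\<Sum>k\<in>{..<n} - I. r k * a (\<phi> k)) \<le> (\<Sum>k\<in>{..<n} - I. r k * b)"
      proof (intro sum_mono mult_left_mono ab)
        fix k assume "k \<in> {..<n} - I"
        then show "- int m \<le> \<phi> k" "\<phi> k \<le> 0" "0 \<le> r k"
          using \<phi>(2)[of k] r[of k] by (auto simp: I_def)
      qed
      also have "\<dots> \<le> (\<Sum>k<m. r k * b)"
      proof (rule sum_mono2)
        show "{..<n} - I \<subseteq> {..<m}"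
        proof
          fix k assume "k \<in> {..<n} - I"
          then show "k \<in> {..<m}"
            using \<phi>(2)[of k] by (auto simp: I_def)
        qed
      qed (use r b in \<open>auto simp: less_imp_le\<close>)
      also have "(\<Sum>k\<in>I. r k * a (\<phi> k)) \<le> (\<Sum>k\<in>I. (1 + \<tau>) powr C * (r (nat (\<phi> k)) * a (int (nat (\<phi> k)))))"
      proof (rule sum_mono)
        fix k assume "k \<in> I"
        then have "int (nat (\<phi> k)) = \<phi> k"
          by (simp add: I_def)
        then show "r k * a (\<phi> k) \<le> (1 + \<tau>) powr C * (r (nat (\<phi> k)) * a (int (nat (\<phi> k))))"
          using mult_right_mono[OF r_delay[of "nat (\<phi> k)" k] a0[of "\<phi> k"]] by (simp add: mult.assoc)
      qed
      also have "\<dots> = (\<Sum>j<n. real (card {k\<in>I. nat (\<phi> k) = j}) * ((1 + \<tau>) powr C * (r j * a (int j))))"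
      proof (rule sum_fun_comp)
        have "nat (\<phi> k) < n" if "k < n" "0 \<le> \<phi> k" for k
          using \<phi>(1)[of k] that by linarith
        then show "(\<lambda>k. nat (\<phi> k)) ` I \<subseteq> {..<n}"
          by (auto simp: I_def)
      qed (auto simp: I_def)
      also have "\<dots> \<le> (\<Sum>j<n. N * ((1 + \<tau>) powr C * (r j * a (int j))))"
      proof (intro sum_mono mult_right_mono)
        fix j
        have "{k\<in>I. nat (\<phi> k) = j} \<subseteq> {k\<in>{..<n}. \<phi> k = int j}"
          by (auto simp: I_def)
        then have "card {k\<in>I. nat (\<phi> k) = j} \<le> card {k\<in>{..<n}. \<phi> k = int j}"
          by (intro card_mono) auto
        then show "real (card {k\<in>I. nat (\<phi> k) = j}) \<le> N"
          using fibre[of n "int j"] by linarith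
        show "0 \<le> (1 + \<tau>) powr C * (r j * a (int j))"
          using r[of j] a0[of "int j"] by simp
      qed
      finally show ?thesis
        by (simp add: sum_distrib_left)
    qed
    then have "q * (\<Sum>k<n. r k * a (\<phi> k)) \<le> q * ((\<Sum>k<m. r k * b) + N * ((1 + \<tau>) powr C * (\<Sum>j<n. r j * a (int j))))"
      using q by (intro mult_left_mono)
    moreover have "(\<Sum>k<n. s k) \<le> suminf s"
      using \<open>summable s\<close> s0 by (intro sum_le_suminf) auto
    \<comment> \<open>After regrouping, all multiples of the sum of \<open>r k * a k\<close> combine
      into the one coefficient whose sign \<open>neg\<close> prescribes.\<close>
    moreover have "(C - p + q * N * (1 + \<tau>) powr C) * (\<Sum>k<n. r k * a (int k)) \<le> 0"
      using neg r a0 by (intro mult_nonpos_nonneg sum_nonneg) (auto simp: less_imp_le)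
    moreover have "a 0 \<le> b"
      using ab[of 0] by simp
    ultimately have "w n * a (int n) \<le> Z + (\<Sum>k<n. w (Suc k) * \<zeta> k)"
      using * unfolding Z_def by (simp add: algebra_simps)
    then show ?thesis
      by (simp add: w_def)
  qed
  then show ?thesis
    by blast
qed

section \<open>From power bounds to logarithmic rates\<close>

lemma elog_le_ln:
  assumes "x \<le> ennreal y" "y > 0"
  shows "elog x \<le> ereal (ln y)"
proof (cases x)
  case (real z)
  then show ?thesis
    using assms by (auto simp: elog_def ennreal_le_iff2 less_le)
next
  case top
  then show ?thesis
    using assms by (simp add: top_unique)
qed

text \<open>A multiplicative constant contributes only ln c / ln(1 + n \<open>\<Delta>\<close>),
  which tends to 0. The case n = 0 is excluded as its denominator is ln 1 = 0.\<close>

lemma limsup_elog_ratio_le: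
  fixes e :: "nat \<Rightarrow> ennreal"
  assumes \<Delta>: "\<Delta> > 0" and c: "c > 0"
    and e: "\<And>n. e n \<le> ennreal (c * (1 + real n * \<Delta>) powr (- p))"
  shows "limsup (\<lambda>n. elog (e n) / ereal (ln (1 + real n * \<Delta>))) \<le> ereal (- p)"
proof -
  have "eventually (\<lambda>n. elog (e n) / ereal (ln (1 + real n * \<Delta>)) \<le> ereal (ln c / ln (1 + real n * \<Delta>) - p)) sequentially"
    using eventually_gt_at_top[of 0]
  proof eventually_elim
    case (elim n)
    then have n: "1 + real n * \<Delta> > 1"
      using \<Delta> by simp
    have "elog (e n) \<le> ereal (ln (c * (1 + real n * \<Delta>) powr (- p)))"
      using n c by (intro elog_le_ln e) auto
    also have "\<dots> = ereal (ln c - p * ln (1 + real n * \<Delta>))"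
      using n c by (simp add: ln_mult ln_powr)
    finally have "elog (e n) / ereal (ln (1 + real n * \<Delta>)) \<le> ereal (ln c - p * ln (1 + real n * \<Delta>)) / ereal (ln (1 + real n * \<Delta>))"
      using n by (intro ereal_divide_right_mono) auto
    also have "\<dots> = ereal (ln c / ln (1 + real n * \<Delta>) - p)"
      using ln_gt_zero[OF n] by (simp add: diff_divide_distrib del: ln_gt_zero_iff)
    finally show ?case .
  qed
  then have "limsup (\<lambda>n. elog (e n) / ereal (ln (1 + real n * \<Delta>))) \<le> limsup (\<lambda>n. ereal (ln c / ln (1 + real n * \<Delta>) - p))"
    by (rule Limsup_mono)
  also have "\<dots> = ereal (- p)"
  proof (rule lim_imp_Limsup)
    have "filterlim (\<lambda>n. 1 + real n * \<Delta>) at_top sequentially"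
      using \<Delta> by (intro filterlim_tendsto_add_at_top[OF tendsto_const]
          filterlim_at_top_mult_tendsto_pos[OF tendsto_const _ filterlim_real_sequentially]) auto
    then have "filterlim (\<lambda>n. ln (1 + real n * \<Delta>)) at_top sequentially"
      by (rule filterlim_compose[OF ln_at_top])
    then have "(\<lambda>n. ln c / ln (1 + real n * \<Delta>) - p) \<longlonglongrightarrow> 0 - p"
      by (intro tendsto_diff tendsto_const tendsto_divide_0[OF tendsto_const] filterlim_at_top_imp_at_infinity)
    then show "(\<lambda>n. ereal (ln c / ln (1 + real n * \<Delta>) - p)) \<longlonglongrightarrow> ereal (- p)"
      by simp
  qed simp
  finally show ?thesis .
qed

section \<open>Martingales and Gaussian increments\<close>

text \<open>Doob's maximal inequality bounds the probability of ever reaching level c by E(U 0) / c,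
  and c tends to infinity. The martingale property is stated through integrals over events of
  \<open>G n\<close>, the form in which the noise terms provide it.\<close>

lemma (in prob_space) nonneg_martingale_AE_bounded:
  fixes U :: "nat \<Rightarrow> 'a \<Rightarrow> real"
  assumes sub: "\<And>n. subalgebra M (G n)"
    and mono: "\<And>m n. m \<le> n \<Longrightarrow> sets (G m) \<subseteq> sets (G n)"
    and meas: "\<And>n. U n \<in> borel_measurable (G n)"
    and int: "\<And>n. integrable M (U n)"
    and nonneg: "\<And>n \<omega>. \<omega> \<in> space M \<Longrightarrow> 0 \<le> U n \<omega>"
    and mart: "\<And>n A. A \<in> sets (G n) \<Longrightarrow> (\<integral>\<omega>. indicator A \<omega> * U (Suc n) \<omega> \<partial>M) = (\<integral>\<omega>. indicator A \<omega> * U n \<omega> \<partial>M)"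
  shows "AE \<omega> in M. \<exists>c. \<forall>n. U n \<omega> \<le> c"
proof -
  have spG: "space (G n) = space M" and setsG: "sets (G n) \<subseteq> sets M" for n
    using sub[of n] by (auto simp: subalgebra_def)
  have mart': "(\<integral>\<omega>. indicator A \<omega> * U n \<omega> \<partial>M) = (\<integral>\<omega>. indicator A \<omega> * U k \<omega> \<partial>M)"
    if "k \<le> n" "A \<in> sets (G k)" for k n A
    using that(1)
  proof (induction rule: dec_induct)
    case (step n)
    then show ?case
      using mart[of A n] mono[of k n] that(2) by auto
  qed simp
  have E: "expectation (U n) = expectation (U 0)" for n
  proof -
    have "(\<integral>\<omega>. indicator (space M) \<omega> * U n \<omega> \<partial>M) = (\<integral>\<omega>. indicator (space M) \<omega> * U 0 \<omega> \<partial>M)"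
      using mart'[of 0 n "space M"] spG[of 0] by (metis le0 sets.top)
    moreover have "(\<integral>\<omega>. indicator (space M) \<omega> * U n \<omega> \<partial>M) = expectation (U n)" for n
      by (intro Bochner_Integration.integral_cong) auto
    ultimately show ?thesis by simp
  qed
  have measU[measurable]: "U n \<in> borel_measurable M" for n
    using int by auto
  define T where "T c k = {\<omega>\<in>space M. c \<le> U k \<omega>}" for c k
  have T: "T c k \<in> sets (G k)" for c k
    using measurable_sets[OF meas[of k], of "{c..}"] spG[of k]
    by (simp add: T_def vimage_def Int_def conj_commute)
  have doob: "c * prob (\<Union>k\<le>n. T c k) \<le> expectation (U 0)" if "c > 0" for c n
  proof -
    \<comment> \<open>\<open>A k\<close> is the event that level c is reached at time k for the
      first time. It belongs to \<open>G k\<close>, so the integral of \<open>U k\<close> over it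
      may be replaced by that of \<open>U n\<close>; disjointness then bounds the sum of these by
      the expectation of \<open>U n\<close>.\<close>
    define A where "A = disjointed (T c)"
    have A: "A k \<in> sets (G k)" for k
    proof -
      have "(\<Union>i\<in>{0..<k}. T c i) \<in> sets (G k)"
        using T mono[of _ k] by (intro sets.finite_UN) (auto intro: less_imp_le)
      then show ?thesis
        unfolding A_def disjointed_def using T by auto
    qed
    then have AM: "A k \<in> sets M" for k
      using setsG by blast
    have intA: "integrable M (\<lambda>\<omega>. indicator (A k) \<omega> * U j \<omega>)" for k j
      using integrable_real_mult_indicator[OF AM int] by (simp add: mult.commute)
    have "(\<Union>k\<le>n. T c k) = (\<Union>k\<le>n. A k)"
      using finite_UN_disjointed_eq[of "T c" "Suc n"]
      by (simp add: A_def atLeast0LessThan lessThan_Suc_atMost)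
    then have "c * prob (\<Union>k\<le>n. T c k) = c * (\<Sum>k\<le>n. prob (A k))"
      using AM disjoint_family_disjointed[of "T c"]
      by (subst finite_measure_finite_Union[symmetric]) (auto simp: A_def disjoint_family_on_def)
    also have "\<dots> = (\<Sum>k\<le>n. \<integral>\<omega>. c * indicator (A k) \<omega> \<partial>M)"
      unfolding sum_distrib_left Bochner_Integration.integral_mult_right_zero
      using sets.sets_into_space[OF AM] by (simp add: Int_absorb2)
    also have "\<dots> \<le> (\<Sum>k\<le>n. \<integral>\<omega>. indicator (A k) \<omega> * U k \<omega> \<partial>M)"
    proof (intro sum_mono integral_mono intA Bochner_Integration.integrable_mult_right integrable_real_indicator AM)
      fix k \<omega> assume "\<omega> \<in> space M"
      show "c * indicator (A k) \<omega> \<le> indicator (A k) \<omega> * U k \<omega>"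
        using disjointed_subset[of "T c" k] by (auto simp: A_def T_def indicator_def)
    qed (simp add: less_top[symmetric])
    also have "\<dots> = (\<Sum>k\<le>n. \<integral>\<omega>. indicator (A k) \<omega> * U n \<omega> \<partial>M)"
      by (intro sum.cong refl mart'[symmetric] A) auto
    also have "\<dots> = (\<integral>\<omega>. (\<Sum>k\<le>n. indicator (A k) \<omega> * U n \<omega>) \<partial>M)"
      by (rule Bochner_Integration.integral_sum[symmetric]) (rule intA)
    also have "\<dots> \<le> expectation (U n)"
    proof (intro integral_mono int Bochner_Integration.integrable_sum intA)
      fix \<omega> assume \<omega>: "\<omega> \<in> space M"
      have "(\<Sum>k\<le>n. indicator (A k) \<omega> :: real) = indicator (\<Union>k\<le>n. A k) \<omega>"
        using disjoint_family_disjointed[of "T c"]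
        by (intro indicator_UN_disjoint[symmetric]) (auto simp: A_def disjoint_family_on_def)
      then have le1: "(\<Sum>k\<le>n. indicator (A k) \<omega> :: real) \<le> 1"
        by (simp add: indicator_le_1)
      show "(\<Sum>k\<le>n. indicator (A k) \<omega> * U n \<omega>) \<le> U n \<omega>"
        using mult_right_mono[OF le1 nonneg[OF \<omega>, of n]] by (simp only: sum_distrib_right mult_1)
    qed
    finally show ?thesis
      unfolding E[of n] .
  qed
  have TM[measurable]: "T c k \<in> sets M" for c k
    by (simp add: T_def)
  have bound: "c * prob (\<Union>k. T c k) \<le> expectation (U 0)" if "c > 0" for c
  proof (rule LIMSEQ_le_const2)
    have "(\<lambda>n. prob (\<Union>k\<le>n. T c k)) \<longlonglongrightarrow> prob (\<Union>n. \<Union>k\<le>n. T c k)"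
      by (intro finite_Lim_measure_incseq) (auto simp: incseq_def, force)
    moreover have "(\<Union>n. \<Union>k\<le>n. T c k) = (\<Union>k. T c k)"
      by auto
    ultimately show "(\<lambda>n. c * prob (\<Union>k\<le>n. T c k)) \<longlonglongrightarrow> c * prob (\<Union>k. T c k)"
      by (intro tendsto_mult tendsto_const) simp
  qed (use doob that in auto)
  \<comment> \<open>Unbounded paths reach every level; restricting to integer levels makes this a
    countable intersection.\<close>
  define Bad where "Bad = (\<Inter>j::nat. \<Union>k. T (real j) k)"
  have [measurable]: "Bad \<in> sets M"
    unfolding Bad_def by measurable
  have "prob Bad \<le> 0"
  proof (rule field_le_epsilon)
    fix e :: real assume "e > 0"
    obtain j :: nat where j: "real j > max 0 (expectation (U 0) / e)"
      using reals_Archimedean2 by blast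
    have "prob Bad \<le> prob (\<Union>k. T (real j) k)"
      by (intro finite_measure_mono) (auto simp: Bad_def)
    moreover have "prob (\<Union>k. T (real j) k) \<le> e"
    proof -
      have "real j * prob (\<Union>k. T (real j) k) \<le> expectation (U 0)"
        using j by (intro bound) simp
      also have "\<dots> \<le> real j * e"
        using j \<open>e > 0\<close> by (simp add: pos_divide_less_eq mult.commute)
      finally have "real j * prob (\<Union>k. T (real j) k) \<le> real j * e" .
      then show ?thesis
        using j by (subst (asm) mult_le_cancel_left_pos) auto
    qed
    ultimately show "prob Bad \<le> 0 + e"
      by linarith
  qed
  then have "emeasure M Bad = 0"
    by (simp add: emeasure_eq_measure measure_le_0_iff)
  then have "AE \<omega> in M. \<omega> \<notin> Bad"
    by (intro AE_not_in) (simp add: null_setsI)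
  then show ?thesis
  proof (rule AE_mp, intro AE_I2 impI)
    fix \<omega> assume \<omega>: "\<omega> \<in> space M" "\<omega> \<notin> Bad"
    then obtain j :: nat where "\<And>k. \<omega> \<notin> T (real j) k"
      by (auto simp: Bad_def)
    with \<omega> show "\<exists>c. \<forall>n. U n \<omega> \<le> c"
      by (intro exI[of _ "real j"]) (auto simp: T_def not_le intro: less_imp_le)
  qed
qed

text \<open>The sigma-algebras generated by \<open>X\<close> and by \<open>H\<close> of
  \<open>W\<close> lie inside the two independent families, and independence passes to subfamilies.
  The function \<open>H\<close> allows both components of \<open>W\<close> and centred products of
  two components.\<close>

lemma (in prob_space) indep_set_expectation_mult:
  fixes X Y :: "'a \<Rightarrow> real" and W :: "'a \<Rightarrow> 'b::topological_space"
  assumes sub: "subalgebra M G"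
    and indep: "indep_set (sets G) {W -` A \<inter> space M | A. A \<in> sets borel}"
    and X: "X \<in> borel_measurable G" "integrable M X"
    and H: "H \<in> borel_measurable borel" and Y: "integrable M (\<lambda>\<omega>. H (W \<omega>))"
  shows "integrable M (\<lambda>\<omega>. X \<omega> * H (W \<omega>))"
    and "(\<integral>\<omega>. X \<omega> * H (W \<omega>) \<partial>M) = expectation X * (\<integral>\<omega>. H (W \<omega>) \<partial>M)"
proof -
  have sp: "space G = space M"
    using sub by (simp add: subalgebra_def)
  have "{X -` A \<inter> space M | A. A \<in> sets borel} \<subseteq> sets G"
    using measurable_sets[OF X(1)] by (auto simp: sp)
  then have 1: "sigma_sets (space M) {X -` A \<inter> space M | A. A \<in> sets borel} \<subseteq> sets G"
    using sets.sigma_sets_subset[of _ G] unfolding sp by blast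
  \<comment> \<open>The preimages under \<open>W\<close> already form a sigma-algebra, so generating
    from a subfamily does not lead out of them.\<close>
  have W: "{W -` A \<inter> space M | A. A \<in> sets borel} = sets (vimage_algebra (space M) W borel)"
    by (rule sets_vimage_algebra2[symmetric]) simp
  have 2: "sigma_sets (space M) {(\<lambda>\<omega>. H (W \<omega>)) -` A \<inter> space M | A. A \<in> sets borel}
     \<subseteq> {W -` A \<inter> space M | A. A \<in> sets borel}"
    unfolding W
  proof (rule sets.sigma_sets_subset[of _ "vimage_algebra (space M) W borel", unfolded space_vimage_algebra],
      fold W, safe)
    fix A :: "real set" assume "A \<in> sets borel"
    then show "\<exists>A'. (\<lambda>\<omega>. H (W \<omega>)) -` A \<inter> space M = W -` A' \<inter> space M \<and> A' \<in> sets borel"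
      using measurable_sets[OF H] by (intro exI[of _ "H -` A"]) auto
  qed
  have "indep_var borel X borel (\<lambda>\<omega>. H (W \<omega>))"
    unfolding indep_var_eq
  proof (intro conjI)
    show "indep_set (sigma_sets (space M) {X -` A \<inter> space M |A. A \<in> sets borel})
       (sigma_sets (space M) {(\<lambda>\<omega>. H (W \<omega>)) -` A \<inter> space M |A. A \<in> sets borel})"
      unfolding indep_set_def
      by (rule indep_sets_mono_sets[OF indep[unfolded indep_set_def]]) (simp add: 1 2 split: bool.split)
  qed (use X Y in auto)
  then show "integrable M (\<lambda>\<omega>. X \<omega> * H (W \<omega>))"
      "(\<integral>\<omega>. X \<omega> * H (W \<omega>) \<partial>M) = expectation X * (\<integral>\<omega>. H (W \<omega>) \<partial>M)"
    using X(2) Y indep_var_integrable indep_var_lebesgue_integral by blast+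
qed

text \<open>The Gaussian law of the increments enters the proof through these first and second
  moments. Mixed moments vanish because distinct components are independent and centred.\<close>

lemma (in prob_space) centred_normal_vector_moments:
  fixes W :: "'a \<Rightarrow> real ^ 'd"
  assumes \<sigma>: "\<sigma> > 0"
    and indep: "indep_vars (\<lambda>_. borel) (\<lambda>i \<omega>. W \<omega> $ i) UNIV"
    and normal: "\<And>i. distributed M lborel (\<lambda>\<omega>. W \<omega> $ i) (normal_density 0 \<sigma>)"
  shows "integrable M (\<lambda>\<omega>. W \<omega> $ i)" "(\<integral>\<omega>. W \<omega> $ i \<partial>M) = 0"
    and "integrable M (\<lambda>\<omega>. W \<omega> $ i * W \<omega> $ j)"
    and "(\<integral>\<omega>. W \<omega> $ i * W \<omega> $ j \<partial>M) = (if i = j then \<sigma>\<^sup>2 else 0)"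
proof -
  show 1: "integrable M (\<lambda>\<omega>. W \<omega> $ i)" for i
    using distributed_integrable[OF normal[of i], of "\<lambda>x. x"] integrable_normal_moment_nz_1[OF \<sigma>, of 0] \<sigma>
    by simp
  show 2: "(\<integral>\<omega>. W \<omega> $ i \<partial>M) = 0" for i
    by (rule normal_distributed_expectation[OF \<sigma> normal])
  have sq: "integrable M (\<lambda>\<omega>. W \<omega> $ i * W \<omega> $ i)" for i
    using distributed_integrable[OF normal[of i], of "\<lambda>x. x\<^sup>2"] integrable_normal_moment[OF \<sigma>, of 0 2] \<sigma>
    by (simp add: power2_eq_square)
  have off: "indep_var borel (\<lambda>\<omega>. W \<omega> $ i) borel (\<lambda>\<omega>. W \<omega> $ j)" if "i \<noteq> j"
    using indep_var_compose[OF indep_var_restrict[OF indep, of "{i}" "{j}"],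
        of "\<lambda>f. f i" borel "\<lambda>f. f j" borel] that by (simp add: comp_def)
  show "integrable M (\<lambda>\<omega>. W \<omega> $ i * W \<omega> $ j)"
    using sq indep_var_integrable[OF off] 1 by (cases "i = j") auto
  show "(\<integral>\<omega>. W \<omega> $ i * W \<omega> $ j \<partial>M) = (if i = j then \<sigma>\<^sup>2 else 0)"
    using normal_distributed_variance[OF \<sigma> normal[of i]] indep_var_lebesgue_integral[OF off] 1 2
    by (cases "i = j") (auto simp: power2_eq_square)
qed

lemma borel_measurable_matrix_vector_mult[measurable (raw)]:
  fixes A :: "'a \<Rightarrow> real ^ 'd ^ 'n"
  assumes "A \<in> borel_measurable M" "x \<in> borel_measurable M"
  shows "(\<lambda>\<omega>. A \<omega> *v x \<omega>) \<in> borel_measurable M"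
  using assms
proof (rule borel_measurable_continuous_Pair)
  show "continuous_on UNIV (\<lambda>p. fst p *v snd p :: real ^ 'n)"
    unfolding matrix_vector_mult_def by (intro continuous_intros)
qed

lemma borel_measurable_vec_component[measurable (raw)]:
  fixes A :: "'a \<Rightarrow> ('b::{second_countable_topology, real_normed_vector}) ^ 'n"
  assumes "A \<in> borel_measurable M"
  shows "(\<lambda>\<omega>. A \<omega> $ i) \<in> borel_measurable M"
  by (rule borel_measurable_continuous_on[OF _ assms]) (intro continuous_intros)

text \<open>Linear growth passes square integrability on; this carries second moments through one
  step of the scheme.\<close>

lemma integrable_power2_bound:
  fixes f :: "'a \<Rightarrow> 'b::{second_countable_topology, real_normed_vector}"
    and g :: "'a \<Rightarrow> 'c::{second_countable_topology, real_normed_vector}"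
    and h :: "'a \<Rightarrow> 'e::real_normed_vector"
  assumes "integrable M (\<lambda>\<omega>. (norm (f \<omega>))\<^sup>2)" "integrable M (\<lambda>\<omega>. (norm (g \<omega>))\<^sup>2)"
    and "h \<in> borel_measurable M"
    and bound: "\<And>\<omega>. \<omega> \<in> space M \<Longrightarrow> norm (h \<omega>) \<le> l * (norm (f \<omega>) + norm (g \<omega>))"
  shows "integrable M (\<lambda>\<omega>. (norm (h \<omega>))\<^sup>2)"
proof (rule Bochner_Integration.integrable_bound)
  show "integrable M (\<lambda>\<omega>. l\<^sup>2 * (2 * ((norm (f \<omega>))\<^sup>2 + (norm (g \<omega>))\<^sup>2)))"
    using assms by auto
  show "AE \<omega> in M. norm ((norm (h \<omega>))\<^sup>2) \<le> norm (l\<^sup>2 * (2 * ((norm (f \<omega>))\<^sup>2 + (norm (g \<omega>))\<^sup>2)))"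
  proof (rule AE_I2)
    fix \<omega> assume "\<omega> \<in> space M"
    then have "(norm (h \<omega>))\<^sup>2 \<le> (l * (norm (f \<omega>) + norm (g \<omega>)))\<^sup>2"
      using bound by (intro power_mono) auto
    also have "\<dots> \<le> l\<^sup>2 * (2 * ((norm (f \<omega>))\<^sup>2 + (norm (g \<omega>))\<^sup>2))"
      unfolding power_mult_distrib
      using zero_le_power2[of "norm (f \<omega>) - norm (g \<omega>)"]
      by (intro mult_left_mono) (auto simp: power2_sum power2_diff)
    finally show "norm ((norm (h \<omega>))\<^sup>2) \<le> norm (l\<^sup>2 * (2 * ((norm (f \<omega>))\<^sup>2 + (norm (g \<omega>))\<^sup>2)))"
      by simp
  qed
qed (use assms in measurable)

lemma integrable_mult_of_power2:
  fixes f g :: "'a \<Rightarrow> real"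
  assumes "integrable M (\<lambda>\<omega>. (f \<omega>)\<^sup>2)" "integrable M (\<lambda>\<omega>. (g \<omega>)\<^sup>2)"
    and [measurable]: "f \<in> borel_measurable M" "g \<in> borel_measurable M"
  shows "integrable M (\<lambda>\<omega>. f \<omega> * g \<omega>)"
proof (rule Bochner_Integration.integrable_bound)
  show "integrable M (\<lambda>\<omega>. (f \<omega>)\<^sup>2 + (g \<omega>)\<^sup>2)"
    using assms by auto
  have "\<bar>x * y\<bar> \<le> x\<^sup>2 + y\<^sup>2" for x y :: real
  proof -
    have "2 * \<bar>x * y\<bar> \<le> x\<^sup>2 + y\<^sup>2"
      using sum_squares_bound[of "\<bar>x\<bar>" "\<bar>y\<bar>"] by (simp add: abs_mult)
    then show ?thesis
      using abs_ge_zero[of "x * y"] by linarith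
  qed
  then show "AE \<omega> in M. norm (f \<omega> * g \<omega>) \<le> norm ((f \<omega>)\<^sup>2 + (g \<omega>)\<^sup>2)"
    by simp
qed simp

text \<open>The quadratic noise term \<open>\<bar>A W\<bar>\<^sup>2 - \<sigma>\<^sup>2 \<bar>A\<bar>\<^sup>2 + 2 \<langle>v, A W\<rangle>\<close> is a finite sum of products of a
  coefficient measurable in the past and a centred function of the increment.\<close>

lemma (in prob_space) noise_term_centred:
  fixes W :: "'a \<Rightarrow> real ^ 'd" and A :: "'a \<Rightarrow> real ^ 'd ^ 'n" and v :: "'a \<Rightarrow> real ^ 'n"
  assumes sub: "subalgebra M G"
    and indepG: "indep_set (sets G) {W -` A \<inter> space M | A. A \<in> sets borel}"
    and \<sigma>: "\<sigma> > 0"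
    and indep: "indep_vars (\<lambda>_. borel) (\<lambda>i \<omega>. W \<omega> $ i) UNIV"
    and normal: "\<And>i. distributed M lborel (\<lambda>\<omega>. W \<omega> $ i) (normal_density 0 \<sigma>)"
    and A: "A \<in> borel_measurable G" "integrable M (\<lambda>\<omega>. (norm (A \<omega>))\<^sup>2)"
    and v: "v \<in> borel_measurable G" "integrable M (\<lambda>\<omega>. (norm (v \<omega>))\<^sup>2)"
    and S: "S \<in> sets G"
  defines "\<zeta> \<equiv> (\<lambda>\<omega>. (norm (A \<omega> *v W \<omega>))\<^sup>2 - \<sigma>\<^sup>2 * (norm (A \<omega>))\<^sup>2 + 2 * (v \<omega> \<bullet> (A \<omega> *v W \<omega>)))"
  shows "integrable M \<zeta>" and "(\<integral>\<omega>. indicator S \<omega> * \<zeta> \<omega> \<partial>M) = 0"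
proof -
  note moments = centred_normal_vector_moments[OF \<sigma> indep normal]
  have AG[measurable]: "(\<lambda>\<omega>. A \<omega> $ i $ j) \<in> borel_measurable G" for i j
    using A(1) by measurable
  have vG[measurable]: "(\<lambda>\<omega>. v \<omega> $ i) \<in> borel_measurable G" for i
    using v(1) by measurable
  have SG: "indicator S \<in> borel_measurable G"
    using S by simp
  have from_G: "X \<in> borel_measurable G \<Longrightarrow> X \<in> borel_measurable M" for X :: "'a \<Rightarrow> real"
    using sub by (rule measurable_from_subalg)
  have A2: "integrable M (\<lambda>\<omega>. (A \<omega> $ i $ j)\<^sup>2)" for i j
  proof (rule Bochner_Integration.integrable_bound[OF A(2)])
    show "AE \<omega> in M. norm ((A \<omega> $ i $ j)\<^sup>2) \<le> norm ((norm (A \<omega>))\<^sup>2)"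
    proof (rule AE_I2)
      fix \<omega>
      have "\<bar>A \<omega> $ i $ j\<bar> \<le> norm (A \<omega>)"
        using component_le_norm_cart[of "A \<omega> $ i" j] Finite_Cartesian_Product.norm_nth_le[of "A \<omega>" i]
        by linarith
      then show "norm ((A \<omega> $ i $ j)\<^sup>2) \<le> norm ((norm (A \<omega>))\<^sup>2)"
        using power_mono[of "\<bar>A \<omega> $ i $ j\<bar>" "norm (A \<omega>)" 2] by simp
    qed
  qed (use from_G[OF AG] in measurable)
  have v2: "integrable M (\<lambda>\<omega>. (v \<omega> $ i)\<^sup>2)" for i
  proof (rule Bochner_Integration.integrable_bound[OF v(2)])
    show "AE \<omega> in M. norm ((v \<omega> $ i)\<^sup>2) \<le> norm ((norm (v \<omega>))\<^sup>2)"
      using power_mono[OF component_le_norm_cart abs_ge_zero, of _ i 2] by simp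
  qed (use from_G[OF vG] in measurable)
  have AA: "integrable M (\<lambda>\<omega>. A \<omega> $ i $ j * A \<omega> $ i $ l)" for i j l
    by (intro integrable_mult_of_power2 A2 from_G AG)
  have vA: "integrable M (\<lambda>\<omega>. v \<omega> $ i * A \<omega> $ i $ j)" for i j
    by (intro integrable_mult_of_power2 A2 v2 from_G AG vG)
  \<comment> \<open>This is the covariance matrix of \<open>W\<close>. Subtracting it entrywise
    centres each summand of the quadratic form, and the subtracted terms add up to
    \<open>\<sigma>\<^sup>2 * (norm (A \<omega>))\<^sup>2\<close>.\<close>
  define c where "c j l = (if j = l then \<sigma>\<^sup>2 else 0)" for j l :: 'd
  have \<zeta>_eq: "\<zeta> \<omega> = (\<Sum>i\<in>UNIV. \<Sum>j\<in>UNIV. \<Sum>l\<in>UNIV. (A \<omega> $ i $ j * A \<omega> $ i $ l) * (W \<omega> $ j * W \<omega> $ l - c j l))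
      + 2 * (\<Sum>i\<in>UNIV. \<Sum>j\<in>UNIV. (v \<omega> $ i * A \<omega> $ i $ j) * W \<omega> $ j)" for \<omega>
  proof -
    have "(norm (A \<omega> *v W \<omega>))\<^sup>2 = (\<Sum>i\<in>UNIV. (\<Sum>j\<in>UNIV. A \<omega> $ i $ j * W \<omega> $ j)\<^sup>2)"
      by (simp add: norm_vec_def L2_set_def sum_nonneg matrix_vector_mult_def)
    also have "\<dots> = (\<Sum>i\<in>UNIV. \<Sum>j\<in>UNIV. \<Sum>l\<in>UNIV. (A \<omega> $ i $ j * A \<omega> $ i $ l) * (W \<omega> $ j * W \<omega> $ l))"
      by (simp add: power2_eq_square sum_product mult_ac)
    finally have 1: "(norm (A \<omega> *v W \<omega>))\<^sup>2 = \<dots>" .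
    have "\<sigma>\<^sup>2 * (norm (A \<omega>))\<^sup>2 = (\<Sum>i\<in>UNIV. \<Sum>j\<in>UNIV. \<sigma>\<^sup>2 * (A \<omega> $ i $ j)\<^sup>2)"
      by (simp add: norm_vec_def L2_set_def sum_nonneg sum_distrib_left)
    also have "\<dots> = (\<Sum>i\<in>UNIV. \<Sum>j\<in>UNIV. \<Sum>l\<in>UNIV. (A \<omega> $ i $ j * A \<omega> $ i $ l) * c j l)"
      by (simp add: c_def if_distrib power2_eq_square mult_ac cong: if_cong)
    finally have 2: "\<sigma>\<^sup>2 * (norm (A \<omega>))\<^sup>2 = \<dots>" .
    have 3: "v \<omega> \<bullet> (A \<omega> *v W \<omega>) = (\<Sum>i\<in>UNIV. \<Sum>j\<in>UNIV. (v \<omega> $ i * A \<omega> $ i $ j) * W \<omega> $ j)"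
      by (simp add: inner_vec_def matrix_vector_mult_def sum_distrib_left mult.assoc)
    show ?thesis
      unfolding \<zeta>_def 1 2 3 by (simp add: right_diff_distrib sum_subtractf)
  qed
  \<comment> \<open>As \<open>A\<close> is only square integrable, a product of two entries is
    merely integrable. Independence from \<open>W\<close> is what makes its product with a quadratic
    expression in \<open>W\<close> integrable.\<close>
  have quad: "integrable M (\<lambda>\<omega>. X \<omega> * (W \<omega> $ j * W \<omega> $ l - c j l))"
      "(\<integral>\<omega>. X \<omega> * (W \<omega> $ j * W \<omega> $ l - c j l) \<partial>M) = 0"
    if "X \<in> borel_measurable G" "integrable M X" for X j l
  proof -
    have [measurable]: "(\<lambda>w :: real ^ 'd. w $ j * w $ l - c j l) \<in> borel_measurable borel"
      by measurable
    note * = indep_set_expectation_mult[OF sub indepG that this]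
    show "integrable M (\<lambda>\<omega>. X \<omega> * (W \<omega> $ j * W \<omega> $ l - c j l))"
      using *(1) moments(3) by simp
    show "(\<integral>\<omega>. X \<omega> * (W \<omega> $ j * W \<omega> $ l - c j l) \<partial>M) = 0"
      using *(2) moments(3)[of j l] moments(4)[of j l] by (simp add: prob_space c_def)
  qed
  have lin: "integrable M (\<lambda>\<omega>. X \<omega> * W \<omega> $ j)" "(\<integral>\<omega>. X \<omega> * W \<omega> $ j \<partial>M) = 0"
    if "X \<in> borel_measurable G" "integrable M X" for X j
  proof -
    have "(\<lambda>w :: real ^ 'd. w $ j) \<in> borel_measurable borel"
      by measurable
    note * = indep_set_expectation_mult[OF sub indepG that this]
    show "integrable M (\<lambda>\<omega>. X \<omega> * W \<omega> $ j)" "(\<integral>\<omega>. X \<omega> * W \<omega> $ j \<partial>M) = 0"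
      using * moments(1,2) by simp_all
  qed
  have AAG: "(\<lambda>\<omega>. A \<omega> $ i $ j * A \<omega> $ i $ l) \<in> borel_measurable G" for i j l
    by measurable
  have vAG: "(\<lambda>\<omega>. v \<omega> $ i * A \<omega> $ i $ j) \<in> borel_measurable G" for i j
    by measurable
  show "integrable M \<zeta>"
    unfolding \<zeta>_eq
    by (intro Bochner_Integration.integrable_add Bochner_Integration.integrable_sum
        Bochner_Integration.integrable_mult_right quad lin AAG vAG AA vA)
  have SM: "S \<in> sets M"
    using S sub by (auto simp: subalgebra_def)
  \<comment> \<open>The indicator of \<open>S\<close> is absorbed into the coefficients; they stay
    \<open>G\<close>-measurable and integrable, so \<open>quad\<close> and \<open>lin\<close> apply
    again.\<close>
  have SAA: "integrable M (\<lambda>\<omega>. indicator S \<omega> * (A \<omega> $ i $ j * A \<omega> $ i $ l))" for i j l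
    using integrable_real_mult_indicator[OF SM AA] by (simp add: mult.commute)
  have SvA: "integrable M (\<lambda>\<omega>. indicator S \<omega> * (v \<omega> $ i * A \<omega> $ i $ j))" for i j
    using integrable_real_mult_indicator[OF SM vA] by (simp add: mult.commute)
  have SAAG: "(\<lambda>\<omega>. indicator S \<omega> * (A \<omega> $ i $ j * A \<omega> $ i $ l)) \<in> borel_measurable G" for i j l
    using S by measurable
  have SvAG: "(\<lambda>\<omega>. indicator S \<omega> * (v \<omega> $ i * A \<omega> $ i $ j)) \<in> borel_measurable G" for i j
    using S by measurable
  note quad_S = quad[OF SAAG SAA] and lin_S = lin[OF SvAG SvA]
  have "(\<lambda>\<omega>. indicator S \<omega> * \<zeta> \<omega>) = (\<lambda>\<omega>.
      (\<Sum>i\<in>UNIV. \<Sum>j\<in>UNIV. \<Sum>l\<in>UNIV. (indicator S \<omega> * (A \<omega> $ i $ j * A \<omega> $ i $ l)) * (W \<omega> $ j * W \<omega> $ l - c j l))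
      + 2 * (\<Sum>i\<in>UNIV. \<Sum>j\<in>UNIV. (indicator S \<omega> * (v \<omega> $ i * A \<omega> $ i $ j)) * W \<omega> $ j))"
    unfolding \<zeta>_eq by (intro ext) (simp add: sum_distrib_left algebra_simps)
  then show "(\<integral>\<omega>. indicator S \<omega> * \<zeta> \<omega> \<partial>M) = 0"
    by (simp add: Bochner_Integration.integral_add Bochner_Integration.integral_sum quad_S lin_S)
qed

section \<open>The truncated Euler--Maruyama scheme\<close>

text \<open>Continuity on a compact interval makes the set of norms bounded above, so that
  \<open>C_norm\<close> is a genuine supremum.\<close>

lemma C_space_norm_le:
  assumes \<phi>: "\<phi> \<in> mspace (C_space \<tau>)" and \<theta>: "\<theta> \<in> {-\<tau>..0}"
  shows "norm (\<phi> \<theta>) \<le> C_norm \<tau> \<phi>"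
proof -
  have "continuous_on {-\<tau>..0} \<phi>"
    using \<phi> by (simp add: C_space_def)
  then have "bounded (\<phi> ` {-\<tau>..0})"
    by (intro compact_imp_bounded compact_continuous_image) auto
  then have "bdd_above ((\<lambda>x. norm (\<phi> x)) ` {-\<tau>..0})"
    by (auto simp: bdd_above_def bounded_iff)
  then show ?thesis
    unfolding C_norm_def using \<theta> by (rule cSUP_upper2) auto
qed

lemma space_C_borel: "space (C_borel \<tau>) = mspace (C_space \<tau>)"
  unfolding C_borel_def
  by (rule space_measure_of) (use openin_subset in fastforce)

text \<open>Evaluation at a point is 1-Lipschitz for the supremum distance, so preimages of open
  sets are open. This turns measurability of the whole initial segment into measurability of its
  grid values.\<close>

lemma measurable_C_borel_eval:
  fixes \<theta> :: real
  assumes \<theta>: "\<theta> \<in> {-\<tau>..0}"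
  shows "(\<lambda>\<phi>. \<phi> \<theta> :: 'e::real_normed_vector) \<in> borel_measurable (C_borel \<tau>)"
proof (rule borel_measurableI)
  fix U :: "'e set" assume U: "open U"
  define V where "V = {\<phi>\<in>mspace (C_space \<tau>). \<phi> \<theta> \<in> U}"
  interpret C: Metric_space "mspace (C_space \<tau>) :: (real \<Rightarrow> 'e) set" "mdist (C_space \<tau>)"
    by (rule Metric_space_mspace_mdist)
  have "openin (mtopology_of (C_space \<tau>)) V"
    unfolding mtopology_of_def C.openin_mtopology
  proof (intro conjI allI impI)
    fix \<phi> assume \<phi>: "\<phi> \<in> V"
    then have "\<phi> \<theta> \<in> U"
      by (simp add: V_def)
    from openE[OF U this] obtain r where r: "r > 0" "ball (\<phi> \<theta>) r \<subseteq> U" .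
    have "C.mball \<phi> r \<subseteq> V"
    proof
      fix \<psi> assume \<psi>: "\<psi> \<in> C.mball \<phi> r"
      then have *: "\<phi> \<in> mspace (C_space \<tau>)" "\<psi> \<in> mspace (C_space \<tau>)" "mdist (C_space \<tau>) \<phi> \<psi> < r"
        unfolding C.in_mball by blast+
      have "mdist euclidean_metric (\<phi> \<theta>) (\<psi> \<theta>) \<le> mdist (C_space \<tau>) \<phi> \<psi>"
        using mdist_cfunspace_imp_mdist_le[OF *(1,2)[unfolded C_space_def] order_refl, of \<theta>] \<theta>
        by (simp add: C_space_def del: mspace_cfunspace)
      then have "\<psi> \<theta> \<in> ball (\<phi> \<theta>) r"
        using *(3) by simp
      then show "\<psi> \<in> V"
        using *(2) r(2) unfolding V_def by blast
    qed
    with r show "\<exists>r>0. C.mball \<phi> r \<subseteq> V"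
      by blast
  qed (auto simp: V_def)
  then have "V \<in> sets (C_borel \<tau>)"
    unfolding C_borel_def using openin_subset[of "mtopology_of (C_space \<tau>)"]
    by (subst sets_measure_of) (auto intro!: sigma_sets.Basic)
  also have "V = (\<lambda>\<phi>. \<phi> \<theta>) -` U \<inter> space (C_borel \<tau>)"
    by (auto simp: V_def space_C_borel)
  finally show "(\<lambda>\<phi>. \<phi> \<theta>) -` U \<inter> space (C_borel \<tau>) \<in> sets (C_borel \<tau>)" .
qed

lemma measurable_time_slice:
  fixes f :: "'a::topological_space \<Rightarrow> 'a \<Rightarrow> real \<Rightarrow> 'b::topological_space"
  assumes f: "(\<lambda>(x, y, t). f x y t) \<in> borel_measurable (restrict_space borel (UNIV \<times> UNIV \<times> {0..}))"
    and t: "t \<ge> 0"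
  shows "(\<lambda>(x, y). f x y t) \<in> borel_measurable borel"
proof -
  have "(\<lambda>p :: 'a \<times> 'a. (fst p, snd p, t)) \<in> borel_measurable borel"
    by (intro borel_measurable_continuous_onI continuous_intros)
  then have "(\<lambda>p :: 'a \<times> 'a. (fst p, snd p, t)) \<in> measurable borel (restrict_space borel (UNIV \<times> UNIV \<times> {0..}))"
    using t by (intro measurable_restrict_space2) auto
  from measurable_compose[OF this f] show ?thesis
    by (simp add: case_prod_unfold)
qed

lemma measurable_truncated:
  fixes f :: "'v::{real_normed_vector, second_countable_topology} \<Rightarrow> 'v \<Rightarrow> real \<Rightarrow> 'w::{real_normed_vector, second_countable_topology}"
  assumes f: "(\<lambda>(x, y). f x y t) \<in> borel_measurable borel"
    and X[measurable]: "X \<in> borel_measurable M" and Y[measurable]: "Y \<in> borel_measurable M"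
  shows "(\<lambda>\<omega>. truncated h \<Delta> f (X \<omega>) (Y \<omega>) t) \<in> borel_measurable M"
proof -
  have comp: "(\<lambda>\<omega>. f (P \<omega>) (Q \<omega>) t) \<in> borel_measurable M"
    if "P \<in> borel_measurable M" "Q \<in> borel_measurable M" for P Q
    using measurable_compose[OF borel_measurable_Pair[OF that] f] by simp
  have [measurable]: "(\<lambda>\<omega>. f (X \<omega>) (Y \<omega>) t) \<in> borel_measurable M"
    by (rule comp) measurable
  have [measurable]: "(\<lambda>\<omega>. f ((h \<Delta> / max (norm (X \<omega>)) (norm (Y \<omega>))) *\<^sub>R X \<omega>)
      ((h \<Delta> / max (norm (X \<omega>)) (norm (Y \<omega>))) *\<^sub>R Y \<omega>) t) \<in> borel_measurable M"
    by (rule comp) measurable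
  show ?thesis
    unfolding truncated_def Let_def by measurable
qed

text \<open>One step size is fixed, and the assumptions are those behind adaptedness, integrability
  and centring. The growth constant \<open>l t\<close> may depend on time arbitrarily, since
  integrability is propagated through finitely many steps; the dissipativity condition enters later,
  through the pathwise bound assumed in \<open>decay_rates\<close>.\<close>

locale mtem_scheme = prob_space M for M :: "'a measure" +
  fixes F :: "real \<Rightarrow> 'a measure" and B :: "real \<Rightarrow> 'a \<Rightarrow> real ^ 'd" and \<xi> :: "'a \<Rightarrow> real \<Rightarrow> real ^ 'n"
    and f :: "real ^ 'n \<Rightarrow> real ^ 'n \<Rightarrow> real \<Rightarrow> real ^ 'n"
    and g :: "real ^ 'n \<Rightarrow> real ^ 'n \<Rightarrow> real \<Rightarrow> real ^ 'd ^ 'n"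
    and \<delta> h l :: "real \<Rightarrow> real" and \<Delta> b :: real and m :: nat
  assumes filtration: "usual_conditions M F"
    and brownian: "brownian_motion M F B"
    and step: "\<Delta> > 0"
    and initial_measurable: "- int m \<le> k \<Longrightarrow> k \<le> 0 \<Longrightarrow> (\<lambda>\<omega>. \<xi> \<omega> (of_int k * \<Delta>)) \<in> borel_measurable (F 0)"
    and initial_bound: "- int m \<le> k \<Longrightarrow> k \<le> 0 \<Longrightarrow> \<omega> \<in> space M \<Longrightarrow> norm (\<xi> \<omega> (of_int k * \<Delta>)) \<le> b"
    and delay_le: "\<lfloor>\<delta> (real j * \<Delta>) / \<Delta>\<rfloor> \<le> int m"
    and delay_ge: "0 \<le> \<lfloor>\<delta> (real j * \<Delta>) / \<Delta>\<rfloor>"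
    and f_measurable: "t \<ge> 0 \<Longrightarrow> (\<lambda>(x, y). f x y t) \<in> borel_measurable borel"
    and g_measurable: "t \<ge> 0 \<Longrightarrow> (\<lambda>(x, y). g x y t) \<in> borel_measurable borel"
    and f_growth: "t \<ge> 0 \<Longrightarrow> norm (truncated h \<Delta> f x y t) \<le> l t * (norm x + norm y)"
    and g_growth: "t \<ge> 0 \<Longrightarrow> norm (truncated h \<Delta> g x y t) \<le> l t * (norm x + norm y)"
begin

abbreviation X :: "int \<Rightarrow> 'a \<Rightarrow> real ^ 'n" where
  "X \<equiv> mtem f g \<delta> h \<xi> B \<Delta>"

text \<open>The floor stands here without the \<open>nat\<close> of the recursion;
  \<open>delay_ge\<close> makes the two agree.\<close>

definition lag :: "nat \<Rightarrow> int" where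
  "lag k = int k - \<lfloor>\<delta> (real k * \<Delta>) / \<Delta>\<rfloor>"

definition drift :: "nat \<Rightarrow> 'a \<Rightarrow> real ^ 'n" where
  "drift k \<omega> = truncated h \<Delta> f (X (int k) \<omega>) (X (lag k) \<omega>) (real k * \<Delta>)"

definition diffusion :: "nat \<Rightarrow> 'a \<Rightarrow> real ^ 'd ^ 'n" where
  "diffusion k \<omega> = truncated h \<Delta> g (X (int k) \<omega>) (X (lag k) \<omega>) (real k * \<Delta>)"

definition increment :: "nat \<Rightarrow> 'a \<Rightarrow> real ^ 'd" where
  "increment k \<omega> = B (real (Suc k) * \<Delta>) \<omega> - B (real k * \<Delta>) \<omega>"

text \<open>The martingale difference in the squared norm: with v = X + \<open>\<Delta>\<close>
  drift, it is the cross term with v plus the squared diffusion term, compensated by its conditional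
  mean.\<close>

definition noise :: "nat \<Rightarrow> 'a \<Rightarrow> real" where
  "noise k \<omega> = (norm (diffusion k \<omega> *v increment k \<omega>))\<^sup>2 - \<Delta> * (norm (diffusion k \<omega>))\<^sup>2
     + 2 * ((X (int k) \<omega> + \<Delta> *\<^sub>R drift k \<omega>) \<bullet> (diffusion k \<omega> *v increment k \<omega>))"

lemma lag_le: "lag k \<le> int k" and lag_ge: "int k - int m \<le> lag k"
  using delay_le[of k] delay_ge[of k] by (simp_all add: lag_def)

lemma X_initial: "k \<le> 0 \<Longrightarrow> X k \<omega> = \<xi> \<omega> (of_int k * \<Delta>)"
  by (subst mtem.simps) simp

lemma X_Suc: "X (int k + 1) \<omega> = X (int k) \<omega> + \<Delta> *\<^sub>R drift k \<omega> + diffusion k \<omega> *v increment k \<omega>"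
  using delay_ge[of k]
  by (subst mtem.simps) (simp add: Let_def drift_def diffusion_def increment_def lag_def add.commute)

text \<open>The square is expanded, and \<open>\<Delta>\<close> times the squared norm of the
  diffusion is added and subtracted. The part besides \<open>noise\<close> has the form bounded in
  \<open>truncated_step_estimate\<close>.\<close>

lemma norm_X_Suc: "(norm (X (int k + 1) \<omega>))\<^sup>2 = (norm (X (int k) \<omega>))\<^sup>2
    + \<Delta> * (2 * (X (int k) \<omega> \<bullet> drift k \<omega>) + (norm (diffusion k \<omega>))\<^sup>2) + \<Delta>\<^sup>2 * (norm (drift k \<omega>))\<^sup>2 + noise k \<omega>"
  unfolding X_Suc noise_def power2_norm_eq_inner
  by (simp add: algebra_simps inner_commute power2_eq_square)

lemma subalgebra_F: "t \<ge> 0 \<Longrightarrow> subalgebra M (F t)"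
  and sets_F_mono: "0 \<le> s \<Longrightarrow> s \<le> t \<Longrightarrow> sets (F s) \<subseteq> sets (F t)"
  using filtration unfolding usual_conditions_def by blast+

lemma measurable_F_mono:
  assumes "0 \<le> s" "s \<le> t" "Y \<in> measurable (F s) N"
  shows "Y \<in> measurable (F t) N"
proof -
  have "space (F s) = space (F t)" "sets (F s) \<subseteq> sets (F t)"
    using assms subalgebra_F[of s] subalgebra_F[of t] sets_F_mono by (auto simp: subalgebra_def)
  then show ?thesis
    using assms(3) measurable_mono by blast
qed

lemma increment_independent:
  "indep_set (sets (F (real k * \<Delta>))) {increment k -` A \<inter> space M | A. A \<in> sets borel}"
  "indep_vars (\<lambda>_. borel) (\<lambda>i \<omega>. increment k \<omega> $ i) UNIV"
  "distributed M lborel (\<lambda>\<omega>. increment k \<omega> $ i) (normal_density 0 (sqrt \<Delta>))"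
proof -
  have st: "0 \<le> real k * \<Delta>" "real k * \<Delta> < real (Suc k) * \<Delta>"
    "real (Suc k) * \<Delta> - real k * \<Delta> = \<Delta>"
    using step by (auto simp: algebra_simps)
  have "\<forall>s\<ge>0. \<forall>t>s. indep_set (sets (F s)) {(\<lambda>\<omega>. B t \<omega> - B s \<omega>) -` A \<inter> space M | A. A \<in> sets borel} \<and>
      indep_vars (\<lambda>_. borel) (\<lambda>i \<omega>. (B t \<omega> - B s \<omega>) $ i) UNIV \<and>
      (\<forall>i. distributed M lborel (\<lambda>\<omega>. (B t \<omega> - B s \<omega>) $ i) (normal_density 0 (sqrt (t - s))))"
    using brownian unfolding brownian_motion_def by blast
  from this[rule_format, OF st(1,2)]
  show "indep_set (sets (F (real k * \<Delta>))) {increment k -` A \<inter> space M | A. A \<in> sets borel}"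
    "indep_vars (\<lambda>_. borel) (\<lambda>i \<omega>. increment k \<omega> $ i) UNIV"
    "distributed M lborel (\<lambda>\<omega>. increment k \<omega> $ i) (normal_density 0 (sqrt \<Delta>))"
    unfolding increment_def[abs_def] st(3) by blast+
qed

lemma measurable_increment: "increment k \<in> borel_measurable (F (real (Suc k) * \<Delta>))"
proof -
  have B: "B t \<in> borel_measurable (F t)" if "t \<ge> 0" for t
    using brownian that by (simp add: brownian_motion_def)
  have "B (real k * \<Delta>) \<in> borel_measurable (F (real (Suc k) * \<Delta>))"
    using step by (intro measurable_F_mono[OF _ _ B]) (auto simp: algebra_simps)
  moreover have "B (real (Suc k) * \<Delta>) \<in> borel_measurable (F (real (Suc k) * \<Delta>))"
    using step by (intro B) auto
  ultimately show ?thesis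
    unfolding increment_def[abs_def] by measurable
qed

lemma coefficients_adapted:
  assumes X: "X (int k) \<in> borel_measurable (F (real k * \<Delta>))" "X (lag k) \<in> borel_measurable (F (real k * \<Delta>))"
    and X2: "integrable M (\<lambda>\<omega>. (norm (X (int k) \<omega>))\<^sup>2)" "integrable M (\<lambda>\<omega>. (norm (X (lag k) \<omega>))\<^sup>2)"
  shows "drift k \<in> borel_measurable (F (real k * \<Delta>))" "integrable M (\<lambda>\<omega>. (norm (drift k \<omega>))\<^sup>2)"
    and "diffusion k \<in> borel_measurable (F (real k * \<Delta>))" "integrable M (\<lambda>\<omega>. (norm (diffusion k \<omega>))\<^sup>2)"
proof -
  have t: "real k * \<Delta> \<ge> 0"
    using step by simp
  show 1: "drift k \<in> borel_measurable (F (real k * \<Delta>))"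
    unfolding drift_def[abs_def] by (intro measurable_truncated f_measurable t X)
  show 2: "diffusion k \<in> borel_measurable (F (real k * \<Delta>))"
    unfolding diffusion_def[abs_def] by (intro measurable_truncated g_measurable t X)
  note M = measurable_from_subalg[OF subalgebra_F[OF t]]
  show "integrable M (\<lambda>\<omega>. (norm (drift k \<omega>))\<^sup>2)"
    using f_growth[OF t] by (intro integrable_power2_bound[OF X2 M[OF 1]]) (simp add: drift_def)
  show "integrable M (\<lambda>\<omega>. (norm (diffusion k \<omega>))\<^sup>2)"
    using g_growth[OF t] by (intro integrable_power2_bound[OF X2 M[OF 2]]) (simp add: diffusion_def)
qed

lemma noise_centred:
  assumes X: "X (int k) \<in> borel_measurable (F (real k * \<Delta>))" "X (lag k) \<in> borel_measurable (F (real k * \<Delta>))"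
    and X2: "integrable M (\<lambda>\<omega>. (norm (X (int k) \<omega>))\<^sup>2)" "integrable M (\<lambda>\<omega>. (norm (X (lag k) \<omega>))\<^sup>2)"
  shows "integrable M (noise k)"
    and "S \<in> sets (F (real k * \<Delta>)) \<Longrightarrow> (\<integral>\<omega>. indicator S \<omega> * noise k \<omega> \<partial>M) = 0"
proof -
  have t: "real k * \<Delta> \<ge> 0"
    using step by simp
  note coeff = coefficients_adapted[OF X X2]
  have v: "(\<lambda>\<omega>. X (int k) \<omega> + \<Delta> *\<^sub>R drift k \<omega>) \<in> borel_measurable (F (real k * \<Delta>))"
    using X(1) coeff(1) by measurable
  have "integrable M (\<lambda>\<omega>. (norm (X (int k) \<omega> + \<Delta> *\<^sub>R drift k \<omega>))\<^sup>2)"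
  proof (rule integrable_power2_bound[OF X2(1) coeff(2) measurable_from_subalg[OF subalgebra_F[OF t] v]])
    fix \<omega>
    have "norm (X (int k) \<omega> + \<Delta> *\<^sub>R drift k \<omega>) \<le> 1 * norm (X (int k) \<omega>) + \<Delta> * norm (drift k \<omega>)"
      using norm_triangle_ineq[of "X (int k) \<omega>" "\<Delta> *\<^sub>R drift k \<omega>"] step by simp
    also have "\<dots> \<le> (1 + \<Delta>) * norm (X (int k) \<omega>) + (1 + \<Delta>) * norm (drift k \<omega>)"
      using step by (intro add_mono mult_right_mono) auto
    finally show "norm (X (int k) \<omega> + \<Delta> *\<^sub>R drift k \<omega>) \<le> (1 + \<Delta>) * (norm (X (int k) \<omega>) + norm (drift k \<omega>))"
      by (simp add: algebra_simps)
  qed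
  note noise = noise_term_centred[OF subalgebra_F[OF t] increment_independent(1) _ increment_independent(2,3) coeff(3,4) v this]
  have "noise k = (\<lambda>\<omega>. (norm (diffusion k \<omega> *v increment k \<omega>))\<^sup>2 - (sqrt \<Delta>)\<^sup>2 * (norm (diffusion k \<omega>))\<^sup>2
     + 2 * ((X (int k) \<omega> + \<Delta> *\<^sub>R drift k \<omega>) \<bullet> (diffusion k \<omega> *v increment k \<omega>)))"
    using step by (simp add: noise_def fun_eq_iff)
  then show "integrable M (noise k)"
     "S \<in> sets (F (real k * \<Delta>)) \<Longrightarrow> (\<integral>\<omega>. indicator S \<omega> * noise k \<omega> \<partial>M) = 0"
    \<comment> \<open>Integrability was derived under the assumption that some event S is given; the
      empty set supplies one.\<close>
    using noise[of S] noise(1)[of "{}"] step by simp_all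
qed

text \<open>The induction treats all indices up to n together because the next value looks back to
  \<open>lag n\<close>. Finite second moments come from the identity \<open>norm_X_Suc\<close>,
  where independence has already taken care of the noise.\<close>

lemma X_adapted_square_integrable:
  assumes "- int m \<le> k" "k \<le> int n"
  shows "X k \<in> borel_measurable (F (real n * \<Delta>)) \<and> integrable M (\<lambda>\<omega>. (norm (X k \<omega>))\<^sup>2)"
  using assms
proof (induction n arbitrary: k)
  case 0
  have "X k = (\<lambda>\<omega>. \<xi> \<omega> (of_int k * \<Delta>))"
    using 0 by (intro ext X_initial) simp
  with initial_measurable[of k] 0 have meas: "X k \<in> borel_measurable (F 0)"
    by simp
  moreover have "integrable M (\<lambda>\<omega>. (norm (X k \<omega>))\<^sup>2)"
  proof (rule integrable_const_bound)
    show "AE \<omega> in M. norm ((norm (X k \<omega>))\<^sup>2) \<le> b\<^sup>2"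
      using initial_bound[of k] 0 X_initial[of k] by (intro AE_I2) (auto intro!: power_mono)
    show "(\<lambda>\<omega>. (norm (X k \<omega>))\<^sup>2) \<in> borel_measurable M"
      using measurable_from_subalg[OF subalgebra_F meas] by measurable
  qed
  ultimately show ?case
    by simp
next
  case (Suc n)
  have mono: "Y \<in> borel_measurable (F (real n * \<Delta>)) \<Longrightarrow> Y \<in> borel_measurable (F (real (Suc n) * \<Delta>))"
    for Y :: "'a \<Rightarrow> 'z::topological_space"
    using step by (elim measurable_F_mono[rotated 2]) (auto simp: algebra_simps)
  show ?case
  proof (cases "k \<le> int n")
    case True
    then show ?thesis
      using Suc mono by blast
  next
    case False
    then have k: "k = int n + 1"
      using Suc.prems by linarith
    have IHn: "X (int n) \<in> borel_measurable (F (real n * \<Delta>))" "X (lag n) \<in> borel_measurable (F (real n * \<Delta>))"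
       "integrable M (\<lambda>\<omega>. (norm (X (int n) \<omega>))\<^sup>2)" "integrable M (\<lambda>\<omega>. (norm (X (lag n) \<omega>))\<^sup>2)"
      using Suc.IH[of "int n"] Suc.IH[of "lag n"] lag_le[of n] lag_ge[of n] by auto
    note coeff = coefficients_adapted[OF IHn]
    have "X k \<in> borel_measurable (F (real (Suc n) * \<Delta>))"
      unfolding k X_Suc[abs_def]
      using mono[OF IHn(1)] mono[OF coeff(1)] mono[OF coeff(3)] measurable_increment[of n] by measurable
    moreover have "integrable M (\<lambda>\<omega>. (norm (X k \<omega>))\<^sup>2)"
    proof -
      have "0 \<le> real n * \<Delta>"
        using step by simp
      note M = measurable_from_subalg[OF subalgebra_F[OF this]]
      have "integrable M (\<lambda>\<omega>. X (int n) \<omega> \<bullet> drift n \<omega>)"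
      proof (rule Bochner_Integration.integrable_bound)
        show "integrable M (\<lambda>\<omega>. (norm (X (int n) \<omega>))\<^sup>2 + (norm (drift n \<omega>))\<^sup>2)"
          using IHn coeff by auto
        show "(\<lambda>\<omega>. X (int n) \<omega> \<bullet> drift n \<omega>) \<in> borel_measurable M"
          using M[OF IHn(1)] M[OF coeff(1)] by measurable
        have "\<bar>x \<bullet> y\<bar> \<le> (norm x)\<^sup>2 + (norm y)\<^sup>2" for x y :: "real ^ 'n"
          using Cauchy_Schwarz_ineq2[of x y] sum_squares_bound[of "norm x" "norm y"]
            mult_nonneg_nonneg[OF norm_ge_zero norm_ge_zero, of x y] by linarith
        then show "AE \<omega> in M. norm (X (int n) \<omega> \<bullet> drift n \<omega>) \<le> norm ((norm (X (int n) \<omega>))\<^sup>2 + (norm (drift n \<omega>))\<^sup>2)"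
          by simp
      qed
      then show ?thesis
        unfolding k norm_X_Suc using IHn(3) coeff(2,4) noise_centred(1)[OF IHn] by simp
    qed
    ultimately show ?thesis by simp
  qed
qed

text \<open>\<open>Z + (\<Sum>k<n. c k * noise k)\<close> is a nonnegative martingale: its mean is \<open>Z\<close> and its paths are
  almost surely bounded.\<close>

lemma decay_rates:
  assumes dom: "\<And>\<omega> n. \<omega> \<in> space M \<Longrightarrow> (1 + real n * \<Delta>) powr C * (norm (X (int n) \<omega>))\<^sup>2 \<le> Z + (\<Sum>k<n. c k * noise k \<omega>)"
  shows "AE \<omega> in M. as_log_rate \<Delta> X \<omega> \<le> ereal (- C / 2)"
    and "ms_log_rate M \<Delta> X \<le> ereal (- C)"
proof -
  define U where "U n \<omega> = Z + (\<Sum>k<n. c k * noise k \<omega>)" for n \<omega>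
  define G where "G n = F (real n * \<Delta>)" for n
  have adapted: "X k \<in> borel_measurable (G n)" "integrable M (\<lambda>\<omega>. (norm (X k \<omega>))\<^sup>2)"
    if "- int m \<le> k" "k \<le> int n" for k n
    using X_adapted_square_integrable[OF that] by (simp_all add: G_def)
  have noise: "integrable M (noise k)" "S \<in> sets (G k) \<Longrightarrow> (\<integral>\<omega>. indicator S \<omega> * noise k \<omega> \<partial>M) = 0" for k S
    using noise_centred(1)[of k] noise_centred(2)[of k S] adapted[of "int k" k] adapted[of "lag k" k] lag_le[of k] lag_ge[of k]
    by (auto simp: G_def)
  have sub: "subalgebra M (G n)" for n
    using step by (auto simp: G_def intro: subalgebra_F)
  have mono: "sets (G i) \<subseteq> sets (G j)" if "i \<le> j" for i j
    unfolding G_def using step that by (intro sets_F_mono) auto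
  have G_mono: "Y \<in> borel_measurable (G j)" if "i \<le> j" "Y \<in> borel_measurable (G i)"
    for i j and Y :: "'a \<Rightarrow> 'z::topological_space"
    using that step unfolding G_def by (elim measurable_F_mono[rotated 2]) auto
  have noise_meas: "noise k \<in> borel_measurable (G (Suc k))" for k
  proof -
    have "X (int k) \<in> borel_measurable (G k)" "X (lag k) \<in> borel_measurable (G k)"
        "integrable M (\<lambda>\<omega>. (norm (X (int k) \<omega>))\<^sup>2)" "integrable M (\<lambda>\<omega>. (norm (X (lag k) \<omega>))\<^sup>2)"
      using lag_le[of k] lag_ge[of k] by (auto intro: adapted)
    from coefficients_adapted(1,3)[OF this[unfolded G_def], folded G_def]
    have "drift k \<in> borel_measurable (G (Suc k))" "diffusion k \<in> borel_measurable (G (Suc k))"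
      by (auto intro: G_mono[of k "Suc k"])
    with adapted(1)[of "int k" "Suc k"] measurable_increment[of k, folded G_def]
    show ?thesis
      unfolding noise_def[abs_def] by measurable
  qed
  have U_int: "integrable M (U n)" for n
    unfolding U_def using noise by auto
  \<comment> \<open>The martingale inherits its sign from the nonnegative weighted square that it
    dominates.\<close>
  have U_nonneg: "0 \<le> U n \<omega>" if "\<omega> \<in> space M" for n \<omega>
    using dom[OF that, of n] unfolding U_def
    by (rule order_trans[rotated]) simp
  have U_meas: "U n \<in> borel_measurable (G n)" for n
    unfolding U_def
    by (intro borel_measurable_add borel_measurable_sum borel_measurable_times borel_measurable_const
        G_mono[OF _ noise_meas]) auto
  have mart: "(\<integral>\<omega>. indicator A \<omega> * U (Suc n) \<omega> \<partial>M) = (\<integral>\<omega>. indicator A \<omega> * U n \<omega> \<partial>M)"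
    if A: "A \<in> sets (G n)" for A n
  proof -
    have AM: "A \<in> sets M"
      using A sub[of n] by (auto simp: subalgebra_def)
    have ind: "integrable M (\<lambda>\<omega>. indicator A \<omega> * Y \<omega>)" if "integrable M Y" for Y :: "'a \<Rightarrow> real"
      using integrable_real_mult_indicator[OF AM that] by (simp add: mult.commute)
    have "(\<lambda>\<omega>. indicator A \<omega> * U (Suc n) \<omega>) = (\<lambda>\<omega>. indicator A \<omega> * U n \<omega> + c n * (indicator A \<omega> * noise n \<omega>))"
      by (simp add: U_def fun_eq_iff algebra_simps)
    then show ?thesis
      using noise(2)[OF A] by (simp add: ind[OF U_int] ind[OF noise(1)])
  qed
  have bounded: "AE \<omega> in M. \<exists>c. \<forall>n. U n \<omega> \<le> c"
    by (rule nonneg_martingale_AE_bounded[where G = G and U = U, OF sub mono U_meas U_int U_nonneg mart])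
  have EU: "expectation (U n) = Z" for n
  proof -
    have "expectation (noise k) = 0" for k
    proof -
      have "space M \<in> sets (G k)"
        using sub[of k] by (metis sets.top subalgebra_def)
      moreover have "(\<integral>\<omega>. indicator (space M) \<omega> * noise k \<omega> \<partial>M) = expectation (noise k)"
        by (intro Bochner_Integration.integral_cong) auto
      ultimately show ?thesis
        using noise(2) by metis
    qed
    then show ?thesis
      unfolding U_def using noise(1) by (simp add: prob_space)
  qed
  have pos: "1 + real n * \<Delta> > 0" for n
    using step by (simp add: add_pos_nonneg)
  have U_bound: "(norm (X (int n) \<omega>))\<^sup>2 \<le> U n \<omega> * (1 + real n * \<Delta>) powr (- C)" if "\<omega> \<in> space M" for n \<omega>
    using dom[OF that, of n] pos[of n] by (simp add: U_def powr_minus field_simps)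
  show "AE \<omega> in M. as_log_rate \<Delta> X \<omega> \<le> ereal (- C / 2)"
    using bounded
  proof (rule AE_mp, intro AE_I2 impI)
    fix \<omega> assume \<omega>: "\<omega> \<in> space M" "\<exists>c. \<forall>n. U n \<omega> \<le> c"
    then obtain c where c: "\<And>n. U n \<omega> \<le> c"
      by blast
    \<comment> \<open>The pathwise bound may be 0, whereas the rate lemma takes the logarithm of its
      constant. The square root taken below halves the exponent C.\<close>
    define d where "d = max c 1"
    have "norm (X (int n) \<omega>) \<le> sqrt d * (1 + real n * \<Delta>) powr (- (C / 2))" for n
    proof (rule power2_le_imp_le)
      have "(norm (X (int n) \<omega>))\<^sup>2 \<le> d * (1 + real n * \<Delta>) powr (- C)"
        using U_bound[OF \<omega>(1), of n] mult_right_mono[of "U n \<omega>" d "(1 + real n * \<Delta>) powr (- C)"] c[of n]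
        by (simp add: d_def) linarith
      also have "\<dots> = (sqrt d * (1 + real n * \<Delta>) powr (- (C / 2)))\<^sup>2"
      proof -
        have "((1 + real n * \<Delta>) powr (- (C / 2)))\<^sup>2 = (1 + real n * \<Delta>) powr (- C)"
          by (simp add: power2_eq_square powr_add[symmetric])
        then show ?thesis
          by (simp add: power_mult_distrib d_def)
      qed
      finally show "(norm (X (int n) \<omega>))\<^sup>2 \<le> (sqrt d * (1 + real n * \<Delta>) powr (- (C / 2)))\<^sup>2" .
    qed (simp add: d_def)
    then have "limsup (\<lambda>n. elog (ennreal (norm (X (int n) \<omega>))) / ereal (ln (1 + real n * \<Delta>))) \<le> ereal (- (C / 2))"
      using step by (intro limsup_elog_ratio_le[where c = "sqrt d"] ennreal_leI) (auto simp: d_def)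
    then show "as_log_rate \<Delta> X \<omega> \<le> ereal (- C / 2)"
      by (simp add: as_log_rate_def)
  qed
  show "ms_log_rate M \<Delta> X \<le> ereal (- C)"
    unfolding ms_log_rate_def
  proof (rule limsup_elog_ratio_le[where c = "max Z 1"])
    fix n
    have "(\<integral>\<^sup>+\<omega>. ennreal ((norm (X (int n) \<omega>))\<^sup>2) \<partial>M) = ennreal (\<integral>\<omega>. (norm (X (int n) \<omega>))\<^sup>2 \<partial>M)"
      using adapted(2)[of "int n" n] by (intro nn_integral_eq_integral) auto
    also have "(\<integral>\<omega>. (norm (X (int n) \<omega>))\<^sup>2 \<partial>M) \<le> (\<integral>\<omega>. U n \<omega> * (1 + real n * \<Delta>) powr (- C) \<partial>M)"
      using adapted(2)[of "int n" n] U_int[of n] U_bound by (intro integral_mono) auto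
    also have "\<dots> = Z * (1 + real n * \<Delta>) powr (- C)"
      using EU[of n] by simp
    also have "\<dots> \<le> max Z 1 * (1 + real n * \<Delta>) powr (- C)"
      by (intro mult_right_mono) auto
    finally show "(\<integral>\<^sup>+\<omega>. ennreal ((norm (X (int n) \<omega>))\<^sup>2) \<partial>M) \<le> ennreal (max Z 1 * (1 + real n * \<Delta>) powr (- C))"
      by (simp add: ennreal_leI)
  qed (use step in auto)
qed

end

section \<open>Choice of the step threshold and assembly of the rates\<close>

theorem theorem1p6:
  fixes M :: "'a measure"
    and F :: "real \<Rightarrow> 'a measure"
    and B :: "real \<Rightarrow> 'a \<Rightarrow> real ^ 'd"
    and \<xi> :: "'a \<Rightarrow> real \<Rightarrow> real ^ 'n"
    and f :: "real ^ 'n \<Rightarrow> real ^ 'n \<Rightarrow> real \<Rightarrow> real ^ 'n"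
    and g :: "real ^ 'n \<Rightarrow> real ^ 'n \<Rightarrow> real \<Rightarrow> real ^ 'd ^ 'n"
    and \<delta> \<delta>' h :: "real \<Rightarrow> real"
    and L :: "real \<Rightarrow> real \<Rightarrow> real"
    and \<tau> \<Delta>0 \<eta> K lam0 lam1 lam2 :: real
  assumes prob: "prob_space M" "complete_measure M"
    and filt: "usual_conditions M F"
    and bm: "brownian_motion M F B"
    and tau: "\<tau> > 0"
    and xi: "bounded_initial_segment M (F 0) \<tau> \<xi>"
            "(\<integral>\<^sup>+\<omega>. ennreal ((C_norm \<tau> (\<xi> \<omega>))\<^sup>2) \<partial>M) < \<infinity>"
    and delta_C1: "\<forall>t\<ge>0. (\<delta> has_real_derivative \<delta>' t) (at t within {0..})"
                  "continuous_on {0..} \<delta>'"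
    and delta: "\<delta> 0 = \<tau>" "\<forall>t\<ge>0. 0 \<le> \<delta> t \<and> \<delta> t \<le> \<tau>"
    and f_meas: "(\<lambda>(x, y, t). f x y t) \<in> borel_measurable (restrict_space borel (UNIV \<times> UNIV \<times> {0..}))"
    and g_meas: "(\<lambda>(x, y, t). g x y t) \<in> borel_measurable (restrict_space borel (UNIV \<times> UNIV \<times> {0..}))"
    and zero: "\<forall>t\<ge>0. f 0 0 t = 0" "\<forall>t\<ge>0. g 0 0 t = 0"
    and h_dom: "\<Delta>0 > 0"
    and h_pos: "\<forall>\<Delta>\<in>{0<..\<Delta>0}. h \<Delta> > 0"
    and h_dec: "antimono_on {0<..\<Delta>0} h"
    and h_inv: "inj_on h {0<..\<Delta>0}" "\<exists>R0. \<forall>R\<ge>R0. R \<in> h ` {0<..\<Delta>0}"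
    and h_lim: "filterlim h at_top (at_right 0)"
    \<comment> \<open>(i)\<close>
    and eta: "\<eta> < 1" "\<forall>t\<ge>0. \<delta>' t \<le> \<eta>"
    \<comment> \<open>(ii)\<close>
    and L_pos: "\<forall>t\<ge>0. \<forall>R>0. L R t > 0"
    and L_mono: "\<forall>t\<ge>0. mono_on {0<..} (\<lambda>R. L R t)"
    and local_Lipschitz: "\<forall>t\<ge>0. \<forall>R>0. \<forall>x x' y y'.
        max (max (norm x) (norm x')) (max (norm y) (norm y')) \<le> R \<longrightarrow>
        max (norm (f x y t - f x' y' t)) (frobenius_norm (g x y t - g x' y' t))
          \<le> L R t * (norm (x - x') + norm (y - y'))"
    \<comment> \<open>(iii)\<close>
    and params: "K > 0" "lam0 > 0" "lam1 > 0" "lam2 > 0"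
    and khasminskii: "\<forall>t\<ge>0. \<forall>x y. 2 * (x \<bullet> f x y t) + (frobenius_norm (g x y t))\<^sup>2
        \<le> (K * (1 + t) powr (- lam0) - lam1 * (norm x)\<^sup>2 + lam2 * (norm y)\<^sup>2) / (1 + t)"
    \<comment> \<open>(iv)\<close>
    and gap: "lam1 - lam2 * (real_of_int \<lfloor>inverse (1 - \<eta>)\<rfloor> + 1) > 0"
    \<comment> \<open>(v)\<close>
    and step_cond: "((\<lambda>R. SUP t\<in>{0..}. ereal ((1 + t) * (L R t)\<^sup>2 * the_inv_into {0<..\<Delta>0} h R)) \<longlongrightarrow> 0) at_top"
  shows "as_polynomially_stable M (step_sizes \<tau> \<Delta>0) (mtem f g \<delta> h \<xi> B) \<and>
    ms_polynomially_stable M (step_sizes \<tau> \<Delta>0) (mtem f g \<delta> h \<xi> B) \<and>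
    (\<forall>\<epsilon>. 0 < \<epsilon> \<and> \<epsilon> < (lam1 - lam2 * (real_of_int \<lfloor>inverse (1 - \<eta>)\<rfloor> + 1)) / (real_of_int \<lfloor>inverse (1 - \<eta>)\<rfloor> + 2) \<longrightarrow>
      (\<exists>\<Delta>s>0. \<exists>Ct>0. \<exists>C0.
        {c. c > 0 \<and> c - (lam1 - \<epsilon>) + (lam2 + \<epsilon>) * (real_of_int \<lfloor>inverse (1 - \<eta>)\<rfloor> + 1) * (1 + \<tau>) powr c = 0} = {C0} \<and>
        Ct = min C0 lam0 \<and>
        (\<forall>\<Delta>\<in>step_sizes \<tau> \<Delta>0. \<Delta> \<le> \<Delta>s \<longrightarrow> (\<forall>C. 0 < C \<and> C < Ct \<longrightarrow>
          (AE \<omega> in M. as_log_rate \<Delta> (mtem f g \<delta> h \<xi> B \<Delta>) \<omega> \<le> ereal (- C / 2)) \<and>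
          ms_log_rate M \<Delta> (mtem f g \<delta> h \<xi> B \<Delta>) \<le> ereal (- C)))))"
proof -
  define N where "N = real_of_int \<lfloor>inverse (1 - \<eta>)\<rfloor> + 1"
  have N: "N \<ge> 1"
    using eta(1) by (simp add: N_def)
  have main: "\<exists>\<Delta>s>0. \<exists>Ct>0. \<exists>C0.
      {c. c > 0 \<and> c - (lam1 - \<epsilon>) + (lam2 + \<epsilon>) * N * (1 + \<tau>) powr c = 0} = {C0} \<and>
      Ct = min C0 lam0 \<and>
      (\<forall>\<Delta>\<in>step_sizes \<tau> \<Delta>0. \<Delta> \<le> \<Delta>s \<longrightarrow> (\<forall>C. 0 < C \<and> C < Ct \<longrightarrow>
        (AE \<omega> in M. as_log_rate \<Delta> (mtem f g \<delta> h \<xi> B \<Delta>) \<omega> \<le> ereal (- C / 2)) \<and>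
        ms_log_rate M \<Delta> (mtem f g \<delta> h \<xi> B \<Delta>) \<le> ereal (- C)))"
    if \<epsilon>: "0 < \<epsilon>" "\<epsilon> < (lam1 - lam2 * N) / (N + 1)" for \<epsilon>
  proof -
    \<comment> \<open>The upper bound imposed on \<open>\<epsilon>\<close>, solved for this
      inequality: it makes the function defining \<open>C0\<close> negative at 0.\<close>
    have \<epsilon>N: "(lam2 + \<epsilon>) * N < lam1 - \<epsilon>"
      using \<epsilon>(2) N by (simp add: pos_less_divide_eq algebra_simps)
    obtain C0 where C0: "{c. c > 0 \<and> c - (lam1 - \<epsilon>) + (lam2 + \<epsilon>) * N * (1 + \<tau>) powr c = 0} = {C0}"
      using ex1_root_affine_plus_exponential[OF _ _ \<epsilon>N, of "1 + \<tau>"] params \<epsilon> N tau by auto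
    then have "C0 \<in> {c. c > 0 \<and> c - (lam1 - \<epsilon>) + (lam2 + \<epsilon>) * N * (1 + \<tau>) powr c = 0}"
      by simp
    then have C0_pos: "C0 > 0" and C0_root: "C0 - (lam1 - \<epsilon>) + (lam2 + \<epsilon>) * N * (1 + \<tau>) powr C0 = 0"
      by auto
    \<comment> \<open>Substituting R = \<open>h \<Delta>\<close> turns the inverse function into
      \<open>\<Delta>\<close>. The thresholds \<open>\<epsilon> / 4\<close> and
      \<open>sqrt (2 * K / \<epsilon>)\<close> are those for which the two smallness conditions of
      \<open>truncated_step_estimate\<close> hold with \<open>\<epsilon> / 2\<close> each.\<close>
    have "\<forall>\<^sub>F R in at_top. (SUP t\<in>{0..}. ereal ((1 + t) * (L R t)\<^sup>2 * the_inv_into {0<..\<Delta>0} h R)) < ereal (\<epsilon> / 4)"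
      using order_tendstoD(2)[OF step_cond, of "ereal (\<epsilon> / 4)"] \<epsilon> by simp
    with h_lim have "\<forall>\<^sub>F \<Delta> in at_right 0.
        (SUP t\<in>{0..}. ereal ((1 + t) * (L (h \<Delta>) t)\<^sup>2 * the_inv_into {0<..\<Delta>0} h (h \<Delta>))) < ereal (\<epsilon> / 4)"
      by (rule eventually_compose_filterlim[rotated])
    moreover have "\<forall>\<^sub>F \<Delta> in at_right 0. h \<Delta> \<ge> sqrt (2 * K / \<epsilon>)"
      using h_lim by (simp add: filterlim_at_top)
    ultimately have "\<forall>\<^sub>F \<Delta> in at_right 0.
        (SUP t\<in>{0..}. ereal ((1 + t) * (L (h \<Delta>) t)\<^sup>2 * the_inv_into {0<..\<Delta>0} h (h \<Delta>))) < ereal (\<epsilon> / 4) \<and>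
        h \<Delta> \<ge> sqrt (2 * K / \<epsilon>)"
      by (rule eventually_conj)
    then obtain d where d: "d > 0" and small: "\<And>\<Delta>. 0 < \<Delta> \<Longrightarrow> \<Delta> < d \<Longrightarrow>
        (SUP t\<in>{0..}. ereal ((1 + t) * (L (h \<Delta>) t)\<^sup>2 * the_inv_into {0<..\<Delta>0} h (h \<Delta>))) < ereal (\<epsilon> / 4) \<and>
        h \<Delta> \<ge> sqrt (2 * K / \<epsilon>)"
      unfolding eventually_at_right_field by auto
    \<comment> \<open>The estimates hold for steps strictly below \<open>d\<close>, while the claim
      admits equality with the threshold; hence \<open>d / 2\<close>.\<close>
    have "(AE \<omega> in M. as_log_rate \<Delta> (mtem f g \<delta> h \<xi> B \<Delta>) \<omega> \<le> ereal (- C / 2)) \<and>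
        ms_log_rate M \<Delta> (mtem f g \<delta> h \<xi> B \<Delta>) \<le> ereal (- C)"
      if \<Delta>_step: "\<Delta> \<in> step_sizes \<tau> \<Delta>0" and \<Delta>_d: "\<Delta> \<le> d / 2" and C: "0 < C" "C < min C0 lam0" for \<Delta> C
    proof -
      obtain m :: nat where \<Delta>: "0 < \<Delta>" "\<Delta> < 1" "\<Delta> \<le> \<Delta>0" and m: "\<tau> = real m * \<Delta>"
        using \<Delta>_step by (auto simp: step_sizes_def)
      have h\<Delta>: "h \<Delta> > 0"
        using h_pos \<Delta> by auto
      have inv: "the_inv_into {0<..\<Delta>0} h (h \<Delta>) = \<Delta>"
        using \<Delta> by (intro the_inv_into_f_f h_inv(1)) auto
      have L_small: "2 * ((1 + t) * (L (h \<Delta>) t)\<^sup>2 * \<Delta>) \<le> \<epsilon> / 2" if "t \<ge> 0" for t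
      proof -
        have "ereal ((1 + t) * (L (h \<Delta>) t)\<^sup>2 * \<Delta>) \<le> (SUP t\<in>{0..}. ereal ((1 + t) * (L (h \<Delta>) t)\<^sup>2 * \<Delta>))"
          using that by (intro SUP_upper) auto
        also have "\<dots> < ereal (\<epsilon> / 4)"
          using small[of \<Delta>] \<Delta> \<Delta>_d d unfolding inv by simp
        finally show ?thesis by simp
      qed
      have "2 * K / \<epsilon> \<le> (h \<Delta>)\<^sup>2"
        using small[of \<Delta>] \<Delta> \<Delta>_d d h\<Delta> by (intro sqrt_le_D) auto
      then have K_small: "K / (h \<Delta>)\<^sup>2 \<le> \<epsilon> / 2"
        using \<epsilon> h\<Delta> by (simp add: field_simps)
      \<comment> \<open>Comparison with the origin, where both coefficients vanish, turns the local
        Lipschitz condition into linear growth on the ball.\<close>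
      have f_lip: "norm (f x y t) \<le> L (h \<Delta>) t * (norm x + norm y)"
        and g_lip: "norm (g x y t) \<le> L (h \<Delta>) t * (norm x + norm y)"
        if "t \<ge> 0" "max (norm x) (norm y) \<le> h \<Delta>" for x y t
        using local_Lipschitz[rule_format, OF that(1) h\<Delta>, of x 0 y 0] that(2) h\<Delta> zero that(1)
        by (auto simp: frobenius_norm_eq_norm)
      obtain b where \<xi>: "\<xi> \<in> measurable (F 0) (C_borel \<tau>)" and b: "\<And>\<omega>. \<omega> \<in> space M \<Longrightarrow> C_norm \<tau> (\<xi> \<omega>) \<le> b"
        using xi(1) by (auto simp: bounded_initial_segment_def)
      have space_F0: "space (F 0) = space M"
        using filt by (simp add: usual_conditions_def subalgebra_def)
      have grid: "of_int k * \<Delta> \<in> {-\<tau>..0}" if "- int m \<le> k" "k \<le> 0" for k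
        using that \<Delta>(1) mult_right_mono[of "- real m" "of_int k" \<Delta>]
        by (auto simp: m mult_nonpos_nonneg)
      have floor_bounds: "\<lfloor>\<delta> (real j * \<Delta>) / \<Delta>\<rfloor> \<le> int m" "0 \<le> \<lfloor>\<delta> (real j * \<Delta>) / \<Delta>\<rfloor>" for j
      proof -
        have "0 \<le> \<delta> (real j * \<Delta>)" "\<delta> (real j * \<Delta>) \<le> real m * \<Delta>"
          using delta(2) \<Delta>(1) m by auto
        then have "0 \<le> \<delta> (real j * \<Delta>) / \<Delta>" "\<delta> (real j * \<Delta>) / \<Delta> \<le> real m"
          using \<Delta>(1) by (auto simp: field_simps)
        then show "\<lfloor>\<delta> (real j * \<Delta>) / \<Delta>\<rfloor> \<le> int m" "0 \<le> \<lfloor>\<delta> (real j * \<Delta>) / \<Delta>\<rfloor>"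
          by (auto simp: floor_le_iff)
      qed
      interpret prob_space M by fact
      interpret mtem_scheme M F B \<xi> f g \<delta> h "\<lambda>t. L (h \<Delta>) t" \<Delta> b m
      proof
        fix k assume k: "- int m \<le> k" "k \<le> 0"
        show "(\<lambda>\<omega>. \<xi> \<omega> (of_int k * \<Delta>)) \<in> borel_measurable (F 0)"
          using measurable_compose[OF \<xi> measurable_C_borel_eval[OF grid[OF k]]] .
        fix \<omega> assume \<omega>: "\<omega> \<in> space M"
        then have "\<xi> \<omega> \<in> mspace (C_space \<tau>)"
          using measurable_space[OF \<xi>] space_F0 by (simp add: space_C_borel del: mspace_cfunspace)
        from order_trans[OF C_space_norm_le[OF this grid[OF k]] b[OF \<omega>]]
        show "norm (\<xi> \<omega> (of_int k * \<Delta>)) \<le> b" .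
      next
        fix t :: real and x y assume "t \<ge> 0"
        then show "norm (truncated h \<Delta> f x y t) \<le> L (h \<Delta>) t * (norm x + norm y)"
          "norm (truncated h \<Delta> g x y t) \<le> L (h \<Delta>) t * (norm x + norm y)"
          using f_lip g_lip h\<Delta> by (auto intro: norm_truncated_le)
      qed (use filt bm \<Delta>(1) floor_bounds measurable_time_slice[OF f_meas] measurable_time_slice[OF g_meas] in auto)
      define a where "a \<omega> k = (norm (X k \<omega>))\<^sup>2" for \<omega> k
      have rec: "a \<omega> (int k + 1) \<le> a \<omega> (int k) + \<Delta> * ((K * (1 + real k * \<Delta>) powr (- lam0)
          - (lam1 - \<epsilon>) * a \<omega> (int k) + (lam2 + \<epsilon>) * a \<omega> (lag k)) / (1 + real k * \<Delta>)) + noise k \<omega>" for \<omega> k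
      proof -
        have t: "real k * \<Delta> \<ge> 0"
          using \<Delta>(1) by simp
        \<comment> \<open>At a fixed time the decaying term acts as a constant. For the truncation
          error the bound \<open>K\<close> is enough, while the decay itself is kept for
          summability.\<close>
        define \<kappa> where "\<kappa> = K * (1 + real k * \<Delta>) powr (- lam0)"
        have "(1 + real k * \<Delta>) powr (- lam0) \<le> 1"
          using t params powr_mono[of "- lam0" 0 "1 + real k * \<Delta>"] by simp
        then have \<kappa>: "0 \<le> \<kappa>" "\<kappa> \<le> K"
          using params by (auto simp: \<kappa>_def mult_left_le)
        have "\<kappa> / (h \<Delta>)\<^sup>2 \<le> \<epsilon> / 2"
          using order_trans[OF divide_right_mono[OF \<kappa>(2)] K_small] by simp
        from truncated_step_estimate[where f = f and g = g and p = lam1 and q = lam2 and x = "X (int k) \<omega>" and y = "X (lag k) \<omega>",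
            OF h\<Delta> \<Delta>(1) t \<kappa>(1) this L_small[OF t] f_growth[OF t]]
        have "\<Delta> * (2 * (X (int k) \<omega> \<bullet> drift k \<omega>) + (norm (diffusion k \<omega>))\<^sup>2) + \<Delta>\<^sup>2 * (norm (drift k \<omega>))\<^sup>2
          \<le> \<Delta> * ((\<kappa> - (lam1 - \<epsilon>) * a \<omega> (int k) + (lam2 + \<epsilon>) * a \<omega> (lag k)) / (1 + real k * \<Delta>))"
          using khasminskii t unfolding drift_def diffusion_def a_def \<kappa>_def frobenius_norm_eq_norm by blast
        then show ?thesis
          unfolding a_def norm_X_Suc \<kappa>_def by linarith
      qed
      have fibre: "card {k\<in>{..<n}. lag k = j} \<le> N" for n j
        unfolding N_def lag_def
      proof (rule card_delay_fibre_le[OF \<Delta>(1) eta(1)])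
        fix s t :: real assume st: "0 \<le> s" "s \<le> t"
        have der: "(\<delta> has_derivative (*) (\<delta>' x)) (at x within {s..t})" if "s \<le> x" "x \<le> t" for x
        proof -
          have "x \<ge> 0"
            using st that by linarith
          then have "(\<delta> has_derivative (*) (\<delta>' x)) (at x within {0..})"
            using delta_C1(1) unfolding has_field_derivative_def by blast
          then show ?thesis
            by (rule has_derivative_subset) (use st in auto)
        qed
        obtain x where x: "x \<in> {s..t}" "\<delta> t - \<delta> s = \<delta>' x * (t - s)"
          using mvt_very_simple[of s t \<delta> "\<lambda>x. (*) (\<delta>' x)", OF st(2) der] by blast
        have "\<delta>' x \<le> \<eta>"
          using eta(2) st(1) x(1) by simp
        then have "\<delta>' x * (t - s) \<le> \<eta> * (t - s)"
          using st(2) by (intro mult_right_mono) simp_all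
        then show "\<delta> t - \<delta> s \<le> \<eta> * (t - s)"
          unfolding x(2) .
      qed
      \<comment> \<open>Equality holds at \<open>C0\<close>, and the left-hand side increases with
        C.\<close>
      have neg: "C - (lam1 - \<epsilon>) + (lam2 + \<epsilon>) * N * (1 + \<tau>) powr C \<le> 0"
      proof -
        have "(lam2 + \<epsilon>) * N * (1 + \<tau>) powr C \<le> (lam2 + \<epsilon>) * N * (1 + \<tau>) powr C0"
          using C params \<epsilon> N tau by (intro mult_left_mono powr_mono) auto
        then show ?thesis
          using C0_root C by linarith
      qed
      have coeff: "C < lam0" "0 \<le> K" "0 \<le> lam2 + \<epsilon>"
        using C params \<epsilon> by auto
      obtain Z where Z: "\<forall>(a :: int \<Rightarrow> real) \<zeta> n. (\<forall>k. a k \<ge> 0) \<longrightarrow> (\<forall>k. - int m \<le> k \<and> k \<le> 0 \<longrightarrow> a k \<le> b\<^sup>2) \<longrightarrow>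
          (\<forall>k::nat. a (int k + 1) \<le> a (int k) + \<Delta> * ((K * (1 + real k * \<Delta>) powr (- lam0)
              - (lam1 - \<epsilon>) * a (int k) + (lam2 + \<epsilon>) * a (lag k)) / (1 + real k * \<Delta>)) + \<zeta> k) \<longrightarrow>
          (1 + real n * \<Delta>) powr C * a (int n) \<le> Z + (\<Sum>k<n. (1 + real (Suc k) * \<Delta>) powr C * \<zeta> k)"
        using weighted_delay_inequality[where b = "b\<^sup>2" and \<phi> = lag,
            OF \<Delta>(1,2) m C(1) coeff lag_le lag_ge fibre neg] by blast
      have "(1 + real n * \<Delta>) powr C * (norm (X (int n) \<omega>))\<^sup>2
          \<le> Z + (\<Sum>k<n. (1 + real (Suc k) * \<Delta>) powr C * noise k \<omega>)" if \<omega>: "\<omega> \<in> space M" for \<omega> n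
      proof -
        have "a \<omega> k \<le> b\<^sup>2" if "- int m \<le> k" "k \<le> 0" for k
          using initial_bound[OF that \<omega>] X_initial[OF that(2), of \<omega>] by (simp add: a_def power_mono)
        then show ?thesis
          using Z[rule_format, of "a \<omega>" "\<lambda>k. noise k \<omega>" n] rec[of \<omega>] by (simp add: a_def)
      qed
      then show ?thesis
        using decay_rates[of C Z "\<lambda>k. (1 + real (Suc k) * \<Delta>) powr C"] by blast
    qed
    then show ?thesis
      using d C0 C0_pos params by (intro exI[of _ "d / 2"] conjI exI[of _ "min C0 lam0"] exI[of _ C0]) auto
  qed
  have "0 < (lam1 - lam2 * N) / (N + 1)"
    using gap[folded N_def] N by simp
  then obtain \<epsilon>0 where "0 < \<epsilon>0" "\<epsilon>0 < (lam1 - lam2 * N) / (N + 1)"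
    using dense by blast
  from main[OF this] obtain \<Delta>s Ct where \<Delta>s: "\<Delta>s > 0" "Ct > 0" and rates:
      "\<And>\<Delta> C. \<Delta> \<in> step_sizes \<tau> \<Delta>0 \<Longrightarrow> \<Delta> \<le> \<Delta>s \<Longrightarrow> 0 < C \<Longrightarrow> C < Ct \<Longrightarrow>
        (AE \<omega> in M. as_log_rate \<Delta> (mtem f g \<delta> h \<xi> B \<Delta>) \<omega> \<le> ereal (- C / 2)) \<and>
        ms_log_rate M \<Delta> (mtem f g \<delta> h \<xi> B \<Delta>) \<le> ereal (- C)"
    by blast
  \<comment> \<open>The definitions ask for a strict inequality. The choice C =
    \<open>Ct / 2\<close> gives the rates \<open>- Ct / 4\<close> almost surely and
    \<open>- Ct / 2\<close> in mean square, both strictly below \<open>- Ct / 8\<close>.\<close>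
  have "as_polynomially_stable M (step_sizes \<tau> \<Delta>0) (mtem f g \<delta> h \<xi> B)"
    unfolding as_polynomially_stable_def
  proof (rule exI[of _ \<Delta>s], intro conjI \<Delta>s(1), rule exI[of _ "Ct / 8"], intro conjI ballI impI)
    fix \<Delta> assume "\<Delta> \<in> step_sizes \<tau> \<Delta>0" "\<Delta> \<le> \<Delta>s"
    from rates[OF this, of "Ct / 2"] \<Delta>s
    have "AE \<omega> in M. as_log_rate \<Delta> (mtem f g \<delta> h \<xi> B \<Delta>) \<omega> \<le> ereal (- (Ct / 2) / 2)"
      by simp
    then show "AE \<omega> in M. as_log_rate \<Delta> (mtem f g \<delta> h \<xi> B \<Delta>) \<omega> < ereal (- (Ct / 8))"
      by (rule eventually_mono) (use \<Delta>s in \<open>auto elim!: le_less_trans\<close>)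
  qed (use \<Delta>s in auto)
  moreover have "ms_polynomially_stable M (step_sizes \<tau> \<Delta>0) (mtem f g \<delta> h \<xi> B)"
    unfolding ms_polynomially_stable_def
  proof (rule exI[of _ \<Delta>s], intro conjI \<Delta>s(1), rule exI[of _ "Ct / 8"], intro conjI ballI impI)
    fix \<Delta> assume "\<Delta> \<in> step_sizes \<tau> \<Delta>0" "\<Delta> \<le> \<Delta>s"
    from rates[OF this, of "Ct / 2"] \<Delta>s
    have "ms_log_rate M \<Delta> (mtem f g \<delta> h \<xi> B \<Delta>) \<le> ereal (- (Ct / 2))"
      by simp
    also have "\<dots> < ereal (- (Ct / 8))"
      using \<Delta>s by simp
    finally show "ms_log_rate M \<Delta> (mtem f g \<delta> h \<xi> B \<Delta>) < ereal (- (Ct / 8))" .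
  qed (use \<Delta>s in auto)
  moreover have "N + 1 = real_of_int \<lfloor>inverse (1 - \<eta>)\<rfloor> + 2"
    by (simp add: N_def)
  ultimately show ?thesis
    using main unfolding N_def by (simp only:) blast
qed

end
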